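(* Let $N, l$ be positive integers and let $\mathcal{E}$ be a complex Hilbert space. Let $Z\in\mathcal{B}_N(\mathcal{E})$ and let $B_k\in\mathcal{L}(\mathcal{E})$, $0\le k\le l$, be given. Let $U_\infty,V_\infty:\mathcal{E}^{\oplus(l+1)}\to\bigoplus_{k=0}^\infty\mathcal{E}_k$ be the operators associated with $Z$ and $B_0,\ldots,B_l$ by $$U_\infty^*=\left[\widetilde F^{(l)}_\sigma U\right]_{|\sigma|=0}^\infty,\qquad V_\infty^*=\left[\widetilde F^{(l)}_\sigma V\right]_{|\sigma|=0}^\infty,$$ where $U=[I_{\mathcal E}\ 0\ \ldots\ 0]^*$ ($l$ zeros) and $V=[B_0\ B_1\ \ldots\ B_l]^*$ are operators from $\mathcal{E}$ to $\mathcal{E}^{\oplus(l+1)}$, and, for $1\le k\le N$, $\widetilde F_k^{(l)}\in\mathcal{L}(\mathcal{E}^{\oplus(l+1)})$ is the lower bidiagonal $(l+1)\times(l+1)$ block operator with all diagonal entries equal to $Z_k^*$, all entries on the first subdiagonal equal to $I_{\mathcal E}$, and all other entries $0$. Then there exists $T\in\mathcal{S}(\mathcal{H},\mathcal{E})$ such that $$D^kT_Z=B_k,\qquad k=0,\ldots,l,$$ if and only if the operator $U_\infty^*U_\infty-V_\infty^*V_\infty$ is positive (i.e. positive semidefinite).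
   Context: $\mathcal{L}(\cdot)$ denotes bounded linear operators and $\mathcal{H}=\mathbb{C}^N$ (it enters only through $N$). For $Z=[Z_1\ \ldots\ Z_N]\in\mathcal{L}(\mathcal{E})^N$ put $(Z|Z)=\sum_{k=1}^N Z_k^*Z_k$, and let $\mathcal{B}_N(\mathcal{E})=\{Z\in\mathcal{L}(\mathcal{E})^N : (Z|Z)<I_{\mathcal{E}}\}$, where $<$ means that $I_{\mathcal E}-(Z|Z)$ is positive and boundedly invertible. $\mathbb{F}_N^+$ is the unital free semigroup on generators $1,\ldots,N$; $|\sigma|$ is the length of a word $\sigma$; words are ordered by length and, within a given length, lexicographically. Define $\mathcal{E}_0=\mathcal{E}$ and $\mathcal{E}_k=\mathcal{E}_{k-1}^{\oplus N}$ ($N$ summands) for $k\ge 1$. Thus $\mathcal{E}_k=\bigoplus_{|\sigma|=k}\mathcal{E}$, with summands indexed by words of length $k$ in lexicographic order (the outermost summand index being the first letter). For an operator $X$, $X^{\oplus N}$ is the direct sum of $N$ copies of $X$. For operators $F_1,\ldots,F_N$ on a Hilbert space $\mathcal{G}$ and $\sigma=i_1\cdots i_k$, $F_\sigma=F_{i_1}\cdots F_{i_k}$, $F_\emptyset=I$; for $G:\mathcal{E}\to\mathcal{G}$, $[F_\sigma G]_{|\sigma|=0}^\infty$ denotes the row operator $\bigoplus_{k=0}^\infty\mathcal{E}_k\to\mathcal{G}$ whose entry at the summand $\mathcal{E}$ indexed by $\sigma$ is $F_\sigma G$ (bounded in all cases used here). $\mathcal{U}_{\mathcal T}(\mathcal{H},\mathcal{E})$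 is the set of upper triangular operators $T=[T_{ij}]_{i,j=0}^\infty\in\mathcal{L}(\bigoplus_{k=0}^\infty\mathcal{E}_k)$, $T_{ij}:\mathcal{E}_j\to\mathcal{E}_i$, $T_{ij}=0$ for $i>j$, such that $T_{ij}=T_{i-1,j-1}^{\oplus N}$ for all $1\le i\le j$. $\mathcal{S}(\mathcal{H},\mathcal{E})$ is the set of contractions in $\mathcal{U}_{\mathcal T}(\mathcal{H},\mathcal{E})$. Partial derivatives. For $1\le k\le N$ let $E_k:\mathcal{E}\to\mathcal{E}_1=\mathcal{E}^{\oplus N}$ be the column operator with $I_{\mathcal E}$ in the $k$th position and $0$ elsewhere. Let $F_k^{(l)}=[X_{ij}]_{i,j=0}^l\in\mathcal{L}(\bigoplus_{m=0}^l\mathcal{E}_m)$ be the lower triangular operator with $X_{00}=Z_k^*$, $X_{10}=E_k$, $X_{i0}=0$ for $i>1$, $X_{ij}=0$ for $i<j$, and $X_{ij}=X_{i-1,j-1}^{\oplus N}$ for $i\ge j\ge 1$. Let $U':\mathcal{E}\to\bigoplus_{m=0}^l\mathcal{E}_m$ be the embedding onto the summand $\mathcal{E}_0$. For a word $\tau$ with $|\tau|\le l$, let $L(\tau,Z):\bigoplus_{k=0}^\infty\mathcal{E}_k\to\mathcal{E}$ be the component of the row operator $[F^{(l)}_\sigma U']_{|\sigma|=0}^\infty$ in the summand $\mathcal{E}$ of $\bigoplus_{m=0}^l\mathcal{E}_m$ indexed by $\tau$ (it does not depend on the choice of $l\ge|\tau|$). For $T\in\mathcal{U}_{\mathcal T}(\mathcal{H},\mathcal{E})$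 define $D_\tau T_Z=P_{\mathcal E}\,T\,L(\tau,Z)^*\in\mathcal{L}(\mathcal{E})$, where $P_{\mathcal E}$ is the orthogonal projection of $\bigoplus_{k=0}^\infty\mathcal{E}_k$ onto $\mathcal{E}=\mathcal{E}_0$. Total derivatives. $D^kT_Z=\sum_{|\sigma|=k}D_\sigma T_Z$ for $k\ge 1$, and $D^0T_Z=D_\emptyset T_Z=T(Z)=P_{\mathcal E}TL(Z)^*$, where $L(Z)=L(\emptyset,Z)=[Z^*_\sigma]_{|\sigma|=0}^\infty$, $Z^*_\sigma=Z^*_{i_1}\cdots Z^*_{i_k}$ for $\sigma=i_1\cdots i_k$, $Z^*_\emptyset=I_{\mathcal E}$. *)

theory Defs
  imports "HOL-Analysis.Analysis"
begin

section \<open>Complex Hilbert spaces\<close>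

text \<open>The complex inner product is linear in its first argument; its real part is the real
  inner product inherited from the class \<^class>\<open>real_inner\<close>, which determines norm and topology.\<close>

class complex_hilbert = real_inner + complete_space +
  fixes scaleC :: "complex \<Rightarrow> 'a \<Rightarrow> 'a"  (infixr \<open>*\<^sub>C\<close> 75)
    and cinner :: "'a \<Rightarrow> 'a \<Rightarrow> complex"
  assumes scaleC_add_right: "a *\<^sub>C (x + y) = a *\<^sub>C x + a *\<^sub>C y"
    and scaleC_add_left: "(a + b) *\<^sub>C x = a *\<^sub>C x + b *\<^sub>C x"
    and scaleC_scaleC: "a *\<^sub>C b *\<^sub>C x = (a * b) *\<^sub>C x"
    and scaleR_scaleC: "r *\<^sub>R x = complex_of_real r *\<^sub>C x"
    and cinner_commute: "cinner x y = cnj (cinner y x)"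
    and cinner_add_left: "cinner (x + y) z = cinner x z + cinner y z"
    and cinner_scaleC_left: "cinner (a *\<^sub>C x) y = a * cinner x y"
    and inner_eq_Re_cinner: "inner x y = Re (cinner x y)"

instantiation complex :: complex_hilbert
begin

definition scaleC_complex :: "complex \<Rightarrow> complex \<Rightarrow> complex"
  where "scaleC_complex a x = a * x"

definition cinner_complex :: "complex \<Rightarrow> complex \<Rightarrow> complex"
  where "cinner_complex x y = x * cnj y"

instance
  by standard
    (auto simp: scaleC_complex_def cinner_complex_def algebra_simps inner_complex_def
      scaleR_conv_of_real)

end

definition bounded_clinear :: "('a::complex_hilbert \<Rightarrow> 'b::complex_hilbert) \<Rightarrow> bool" where
  "bounded_clinear A \<longleftrightarrow> bounded_linear A \<and> (\<forall>c x. A (c *\<^sub>C x) = c *\<^sub>C A x)"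

definition cadjoint ::
    "('a::complex_hilbert \<Rightarrow> 'b::complex_hilbert) \<Rightarrow> 'b \<Rightarrow> 'a"  (\<open>_\<dagger>\<close> [1000] 1000) where
  "A\<dagger> = (THE B. \<forall>x y. cinner (A x) y = cinner x (B y))"

text \<open>Positivity of an operator whose domain is the subspace \<open>S\<close>.\<close>

definition positive_on :: "'a::complex_hilbert set \<Rightarrow> ('a \<Rightarrow> 'a) \<Rightarrow> bool" where
  "positive_on S A \<longleftrightarrow> (\<forall>x\<in>S. cinner (A x) x \<in> \<real>\<^sub>\<ge>\<^sub>0)"

definition boundedly_invertible :: "('a::complex_hilbert \<Rightarrow> 'a) \<Rightarrow> bool" where
  "boundedly_invertible A \<longleftrightarrow>
    bounded_clinear A \<and> (\<exists>B. bounded_clinear B \<and> A \<circ> B = id \<and> B \<circ> A = id)"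

section \<open>Hilbert space direct sums\<close>

text \<open>\<open>('i, 'e) hsum\<close> is the Hilbert space direct sum of copies of \<open>'e\<close> indexed by \<open>'i\<close>.\<close>

typedef (overloaded) ('i, 'e) hsum =
    "{f :: 'i \<Rightarrow> 'e::complex_hilbert. (\<lambda>i. (norm (f i))\<^sup>2) summable_on UNIV}"
  morphisms hnth Abs_hsum
  by (rule exI[of _ "\<lambda>_. 0"]) simp

notation hnth  (infixl \<open>$$\<close> 90)

lemma hsum_eqI: "(\<And>i. x $$ i = y $$ i) \<Longrightarrow> x = y"
  by (metis ext hnth_inject)

lemma hsum_eq_iff: "x = y \<longleftrightarrow> (\<forall>i. x $$ i = y $$ i)"
  using hsum_eqI by metis

lemma hnth_summable: "(\<lambda>i. (norm (x $$ i))\<^sup>2) summable_on UNIV"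
  using hnth[of x] by simp

lemma Abs_hsum_nth:
  "(\<lambda>i. (norm (f i))\<^sup>2) summable_on UNIV \<Longrightarrow> Abs_hsum f $$ i = f i"
  by (simp add: Abs_hsum_inverse)

lemma cinner_add_right: "cinner x (y + z) = cinner x y + cinner (x::'a::complex_hilbert) z"
  by (metis cinner_add_left cinner_commute complex_cnj_add)

lemma scaleC_one [simp]: "1 *\<^sub>C x = (x::'a::complex_hilbert)"
  using scaleR_scaleC[of 1 x] by simp

lemma cinner_scaleC_right: "cinner x (a *\<^sub>C y) = cnj a * cinner x (y::'a::complex_hilbert)"
  by (metis cinner_scaleC_left cinner_commute complex_cnj_mult complex_cnj_cnj)

lemma cinner_self: "cinner x x = of_real ((norm (x::'a::complex_hilbert))\<^sup>2)"
proof -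
  have "Im (cinner x x) = 0"
    using arg_cong[OF cinner_commute[of x x], of Im] by simp
  then show ?thesis
    by (simp add: complex_eq_iff inner_eq_Re_cinner[symmetric] power2_norm_eq_inner)
qed

lemma norm_scaleC: "norm (a *\<^sub>C x) = cmod a * norm (x::'a::complex_hilbert)"
proof -
  have "cinner (a *\<^sub>C x) (a *\<^sub>C x) = of_real ((cmod a * norm x)\<^sup>2)"
    unfolding cinner_scaleC_left cinner_scaleC_right cinner_self[of x] power_mult_distrib
      of_real_mult complex_norm_square by (simp add: mult_ac)
  then have "(norm (a *\<^sub>C x))\<^sup>2 = (cmod a * norm x)\<^sup>2"
    unfolding cinner_self of_real_eq_iff .
  then show ?thesis
    by (rule power2_eq_imp_eq) auto
qed

lemma norm_cinner_le: "cmod (cinner x y) \<le> (norm x)\<^sup>2 + (norm (y::'a::complex_hilbert))\<^sup>2"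
proof -
  have "\<bar>Re (cinner x y)\<bar> \<le> norm x * norm y"
    by (metis inner_eq_Re_cinner Cauchy_Schwarz_ineq2)
  moreover have "\<bar>Im (cinner x y)\<bar> \<le> norm x * norm y"
    using Cauchy_Schwarz_ineq2[of "(- \<i>) *\<^sub>C x" y]
    by (simp add: norm_scaleC inner_eq_Re_cinner cinner_scaleC_left)
  ultimately have "cmod (cinner x y) \<le> 2 * (norm x * norm y)"
    using cmod_le[of "cinner x y"] by linarith
  also have "\<dots> \<le> (norm x)\<^sup>2 + (norm y)\<^sup>2"
    using sum_squares_bound[of "norm x" "norm y"] by simp
  finally show ?thesis .
qed

lemma norm2_add_le: "(norm (x + y))\<^sup>2 \<le> 2 * (norm x)\<^sup>2 + 2 * (norm (y::'a::real_normed_vector))\<^sup>2"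
proof -
  have "(norm (x + y))\<^sup>2 \<le> (norm x + norm y)\<^sup>2"
    by (intro power_mono norm_triangle_ineq) auto
  also have "\<dots> \<le> 2 * (norm x)\<^sup>2 + 2 * (norm y)\<^sup>2"
    using sum_squares_bound[of "norm x" "norm y"] by (simp add: power2_sum)
  finally show ?thesis .
qed

lemma summable_norm2_add:
  fixes f g :: "'i \<Rightarrow> 'a::real_normed_vector"
  assumes "(\<lambda>i. (norm (f i))\<^sup>2) summable_on UNIV" "(\<lambda>i. (norm (g i))\<^sup>2) summable_on UNIV"
  shows "(\<lambda>i. (norm (f i + g i))\<^sup>2) summable_on UNIV"
  by (rule summable_on_comparison_test[where f="\<lambda>i. 2 * (norm (f i))\<^sup>2 + 2 * (norm (g i))\<^sup>2"])
    (auto intro!: summable_on_add summable_on_cmult_right assms norm2_add_le)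

lemma summable_norm2_scaleC:
  fixes f :: "'i \<Rightarrow> 'a::complex_hilbert"
  assumes "(\<lambda>i. (norm (f i))\<^sup>2) summable_on UNIV"
  shows "(\<lambda>i. (norm (a *\<^sub>C f i))\<^sup>2) summable_on UNIV"
  by (simp add: norm_scaleC power_mult_distrib summable_on_cmult_right assms)

lemma summable_norm2_diff:
  fixes f g :: "'i \<Rightarrow> 'a::real_normed_vector"
  assumes "(\<lambda>i. (norm (f i))\<^sup>2) summable_on UNIV" "(\<lambda>i. (norm (g i))\<^sup>2) summable_on UNIV"
  shows "(\<lambda>i. (norm (f i - g i))\<^sup>2) summable_on UNIV"
  using summable_norm2_add[of f "\<lambda>i. - g i"] assms by simp

lemma summable_cinner:
  fixes x y :: "('i, 'a::complex_hilbert) hsum"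
  shows "(\<lambda>i. cinner (x $$ i) (y $$ i)) summable_on UNIV"
  by (rule Infinite_Sum.abs_summable_summable,
      rule Infinite_Sum.abs_summable_on_comparison_test'[where g="\<lambda>i. (norm (x $$ i))\<^sup>2 + (norm (y $$ i))\<^sup>2"])
    (auto intro!: summable_on_add hnth_summable norm_cinner_le)

instantiation hsum :: (type, complex_hilbert) real_inner
begin

definition zero_hsum :: "('a, 'b) hsum" where "zero_hsum = Abs_hsum (\<lambda>_. 0)"
definition plus_hsum :: "('a, 'b) hsum \<Rightarrow> ('a, 'b) hsum \<Rightarrow> ('a, 'b) hsum"
  where "plus_hsum x y = Abs_hsum (\<lambda>i. x $$ i + y $$ i)"
definition minus_hsum :: "('a, 'b) hsum \<Rightarrow> ('a, 'b) hsum \<Rightarrow> ('a, 'b) hsum"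
  where "minus_hsum x y = Abs_hsum (\<lambda>i. x $$ i - y $$ i)"
definition uminus_hsum :: "('a, 'b) hsum \<Rightarrow> ('a, 'b) hsum"
  where "uminus_hsum x = Abs_hsum (\<lambda>i. - (x $$ i))"
definition scaleR_hsum :: "real \<Rightarrow> ('a, 'b) hsum \<Rightarrow> ('a, 'b) hsum"
  where "scaleR_hsum r x = Abs_hsum (\<lambda>i. r *\<^sub>R x $$ i)"
definition inner_hsum :: "('a, 'b) hsum \<Rightarrow> ('a, 'b) hsum \<Rightarrow> real"
  where "inner_hsum x y = (\<Sum>\<^sub>\<infinity>i. inner (x $$ i) (y $$ i))"
definition norm_hsum :: "('a, 'b) hsum \<Rightarrow> real"
  where "norm_hsum x = sqrt (inner x x)"
definition sgn_hsum :: "('a, 'b) hsum \<Rightarrow> ('a, 'b) hsum"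
  where "sgn_hsum x = inverse (norm x) *\<^sub>R x"
definition dist_hsum :: "('a, 'b) hsum \<Rightarrow> ('a, 'b) hsum \<Rightarrow> real"
  where "dist_hsum x y = norm (x - y)"
definition uniformity_hsum :: "(('a, 'b) hsum \<times> ('a, 'b) hsum) filter"
  where "uniformity_hsum = (INF e\<in>{0<..}. principal {(x, y). dist x y < e})"
definition open_hsum :: "('a, 'b) hsum set \<Rightarrow> bool"
  where "open_hsum U \<longleftrightarrow> (\<forall>x\<in>U. eventually (\<lambda>(x', y). x' = x \<longrightarrow> y \<in> U) uniformity)"

lemma hnth_zero [simp]: "(0::('a, 'b) hsum) $$ i = 0"
  by (simp add: zero_hsum_def Abs_hsum_nth)

lemma hnth_plus [simp]: "((x::('a, 'b) hsum) + y) $$ i = x $$ i + y $$ i"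
  by (simp add: plus_hsum_def Abs_hsum_nth summable_norm2_add hnth_summable)

lemma hnth_minus [simp]: "((x::('a, 'b) hsum) - y) $$ i = x $$ i - y $$ i"
  by (simp add: minus_hsum_def Abs_hsum_nth summable_norm2_diff hnth_summable)

lemma hnth_uminus [simp]: "(- (x::('a, 'b) hsum)) $$ i = - (x $$ i)"
  by (simp add: uminus_hsum_def Abs_hsum_nth hnth_summable)

lemma hnth_scaleR [simp]: "(r *\<^sub>R (x::('a, 'b) hsum)) $$ i = r *\<^sub>R x $$ i"
  by (simp add: scaleR_hsum_def Abs_hsum_nth hnth_summable power_mult_distrib
      summable_on_cmult_right)

lemma summable_inner:
  fixes x y :: "('a, 'b) hsum"
  shows "(\<lambda>i. inner (x $$ i) (y $$ i)) summable_on UNIV"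
  using summable_on_Re[OF summable_cinner[of x y]] by (simp add: inner_eq_Re_cinner)

instance
proof
  fix x y z :: "('a, 'b) hsum" and a b r :: real
  show "x + y + z = x + (y + z)" "x + y = y + x" "0 + x = x" "- x + x = 0" "x - y = x + - y"
    by (auto intro!: hsum_eqI)
  show "a *\<^sub>R (x + y) = a *\<^sub>R x + a *\<^sub>R y" "(a + b) *\<^sub>R x = a *\<^sub>R x + b *\<^sub>R x"
      "a *\<^sub>R b *\<^sub>R x = (a * b) *\<^sub>R x" "1 *\<^sub>R x = x"
    by (auto intro!: hsum_eqI simp: scaleR_add_right scaleR_add_left)
  show "dist x y = norm (x - y)" by (rule dist_hsum_def)
  show "sgn x = inverse (norm x) *\<^sub>R x" by (rule sgn_hsum_def)
  show "uniformity = (INF e\<in>{0<..}. principal {(x::('a, 'b) hsum, y). dist x y < e})"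
    by (rule uniformity_hsum_def)
  show "open U \<longleftrightarrow> (\<forall>x\<in>U. eventually (\<lambda>(x', y). x' = x \<longrightarrow> y \<in> U) uniformity)"
    for U :: "('a, 'b) hsum set"
    by (rule open_hsum_def)
  show "inner x y = inner y x"
    by (simp add: inner_hsum_def inner_commute)
  show "inner (x + y) z = inner x z + inner y z"
    by (simp add: inner_hsum_def inner_add_left infsum_add summable_inner)
  show "inner (r *\<^sub>R x) y = r * inner x y"
    by (simp add: inner_hsum_def infsum_cmult_right')
  show "0 \<le> inner x x"
    by (simp add: inner_hsum_def infsum_nonneg)
  show "inner x x = 0 \<longleftrightarrow> x = 0"
  proof
    assume "inner x x = 0"
    then have "inner (x $$ i) (x $$ i) = 0" for i
      using nonneg_infsum_le_0D[OF _ summable_inner[of x x], of i]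
      by (simp add: inner_hsum_def)
    then show "x = 0" by (auto intro!: hsum_eqI)
  qed (simp add: inner_hsum_def)
  show "norm x = sqrt (inner x x)" by (rule norm_hsum_def)
qed

end

lemma norm2_hsum: "(norm (x::('i, 'e::complex_hilbert) hsum))\<^sup>2 = (\<Sum>\<^sub>\<infinity>i. (norm (x $$ i))\<^sup>2)"
  by (simp add: power2_norm_eq_inner inner_hsum_def)

lemma sum_norm2_le_hsum:
  "finite F \<Longrightarrow> (\<Sum>i\<in>F. (norm (x $$ i))\<^sup>2) \<le> (norm (x::('i, 'e::complex_hilbert) hsum))\<^sup>2"
  unfolding norm2_hsum by (rule finite_sum_le_infsum) (auto intro: hnth_summable)

lemma norm_hnth_le: "norm (x $$ i) \<le> norm (x::('i, 'e::complex_hilbert) hsum)"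
  using sum_norm2_le_hsum[of "{i}" x] by (simp add: abs_le_square_iff[symmetric])

lemma Cauchy_hsum_convergent:
  fixes X :: "nat \<Rightarrow> ('i, 'e::complex_hilbert) hsum"
  assumes "Cauchy X"
  shows "convergent X"
proof -
  have "Cauchy (\<lambda>n. X n $$ i)" for i
  proof (rule metric_CauchyI)
    fix e :: real assume "e > 0"
    then obtain M where M: "\<forall>m\<ge>M. \<forall>n\<ge>M. dist (X m) (X n) < e"
      using metric_CauchyD[OF assms] by blast
    show "\<exists>M. \<forall>m\<ge>M. \<forall>n\<ge>M. dist (X m $$ i) (X n $$ i) < e"
    proof (intro exI[of _ M] allI impI)
      fix m n assume "M \<le> m" "M \<le> n"
      then have "norm (X m - X n) < e" using M by (simp add: dist_norm)
      then show "dist (X m $$ i) (X n $$ i) < e"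
        using norm_hnth_le[of "X m - X n" i] by (simp add: dist_norm)
    qed
  qed
  then have "\<forall>i. \<exists>l. (\<lambda>n. X n $$ i) \<longlonglongrightarrow> l"
    by (simp add: Cauchy_convergent_iff convergent_def)
  then obtain f where f: "\<And>i. (\<lambda>n. X n $$ i) \<longlonglongrightarrow> f i"
    by metis
  have bound: "(\<Sum>i\<in>F. (norm (X m $$ i - f i))\<^sup>2) \<le> e\<^sup>2"
    if M: "\<forall>m\<ge>M. \<forall>n\<ge>M. dist (X m) (X n) < e" and "m \<ge> M" "finite F" for M m e F
  proof (rule LIMSEQ_le_const2)
    show "(\<lambda>n. \<Sum>i\<in>F. (norm (X m $$ i - X n $$ i))\<^sup>2)
        \<longlonglongrightarrow> (\<Sum>i\<in>F. (norm (X m $$ i - f i))\<^sup>2)"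
      by (intro tendsto_intros f)
    show "\<exists>N. \<forall>n\<ge>N. (\<Sum>i\<in>F. (norm (X m $$ i - X n $$ i))\<^sup>2) \<le> e\<^sup>2"
    proof (intro exI[of _ M] allI impI)
      fix n assume "M \<le> n"
      then have "norm (X m - X n) \<le> e"
        using M \<open>m \<ge> M\<close> by (simp add: dist_norm less_imp_le)
      then have "(norm (X m - X n))\<^sup>2 \<le> e\<^sup>2"
        by (intro power_mono) auto
      then show "(\<Sum>i\<in>F. (norm (X m $$ i - X n $$ i))\<^sup>2) \<le> e\<^sup>2"
        using sum_norm2_le_hsum[OF \<open>finite F\<close>, of "X m - X n"] by simp
    qed
  qed
  have summ: "(\<lambda>i. (norm (X m $$ i - f i))\<^sup>2) summable_on UNIV"
    if "\<forall>m\<ge>M. \<forall>n\<ge>M. dist (X m) (X n) < e" "m \<ge> M" for M m e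
    by (rule nonneg_bdd_above_summable_on)
      (use bound[OF that] in \<open>auto intro!: bdd_aboveI\<close>)
  obtain M1 where M1: "\<forall>m\<ge>M1. \<forall>n\<ge>M1. dist (X m) (X n) < 1"
    using metric_CauchyD[OF assms, of 1] by auto
  have f2: "(\<lambda>i. (norm (f i))\<^sup>2) summable_on UNIV"
    using summable_norm2_diff[OF hnth_summable[of "X M1"] summ[OF M1 order_refl]] by simp
  have "X \<longlonglongrightarrow> Abs_hsum f"
  proof (rule metric_LIMSEQ_I)
    fix r :: real assume "r > 0"
    then obtain M where M: "\<forall>m\<ge>M. \<forall>n\<ge>M. dist (X m) (X n) < r / 2"
      using metric_CauchyD[OF assms, of "r / 2"] by auto
    show "\<exists>M. \<forall>n\<ge>M. dist (X n) (Abs_hsum f) < r"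
    proof (intro exI[of _ M] allI impI)
      fix n assume n: "M \<le> n"
      have "(norm (X n - Abs_hsum f))\<^sup>2 \<le> (r / 2)\<^sup>2"
        unfolding norm2_hsum hnth_minus Abs_hsum_nth[OF f2]
        by (rule infsum_le_finite_sums[OF summ[OF M n]]) (rule bound[OF M n])
      then have "norm (X n - Abs_hsum f) \<le> r / 2"
        by (rule power2_le_imp_le) (use \<open>r > 0\<close> in auto)
      then show "dist (X n) (Abs_hsum f) < r"
        using \<open>r > 0\<close> by (simp add: dist_norm)
    qed
  qed
  then show ?thesis by (auto simp: convergent_def)
qed

instantiation hsum :: (type, complex_hilbert) complex_hilbert
begin

definition scaleC_hsum :: "complex \<Rightarrow> ('a, 'b) hsum \<Rightarrow> ('a, 'b) hsum"
  where "scaleC_hsum c x = Abs_hsum (\<lambda>i. c *\<^sub>C x $$ i)"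
definition cinner_hsum :: "('a, 'b) hsum \<Rightarrow> ('a, 'b) hsum \<Rightarrow> complex"
  where "cinner_hsum x y = (\<Sum>\<^sub>\<infinity>i. cinner (x $$ i) (y $$ i))"

lemma hnth_scaleC [simp]: "(c *\<^sub>C (x::('a, 'b) hsum)) $$ i = c *\<^sub>C x $$ i"
  by (simp add: scaleC_hsum_def Abs_hsum_nth summable_norm2_scaleC hnth_summable)

instance
proof
  fix x y z :: "('a, 'b) hsum" and a b :: complex and r :: real
  show "convergent X" if "Cauchy X" for X :: "nat \<Rightarrow> ('a, 'b) hsum"
    using that by (rule Cauchy_hsum_convergent)
  show "a *\<^sub>C (x + y) = a *\<^sub>C x + a *\<^sub>C y" "(a + b) *\<^sub>C x = a *\<^sub>C x + b *\<^sub>C x"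
      "a *\<^sub>C b *\<^sub>C x = (a * b) *\<^sub>C x" "r *\<^sub>R x = complex_of_real r *\<^sub>C x"
    by (auto intro!: hsum_eqI
        simp: scaleC_add_right scaleC_add_left scaleC_scaleC scaleR_scaleC)
  show "cinner x y = cnj (cinner y x)"
    unfolding cinner_hsum_def infsum_cnj[symmetric] by (intro infsum_cong cinner_commute)
  show "cinner (x + y) z = cinner x z + cinner y z"
    by (simp add: cinner_hsum_def cinner_add_left infsum_add summable_cinner)
  show "cinner (a *\<^sub>C x) y = a * cinner x y"
    by (simp add: cinner_hsum_def cinner_scaleC_left infsum_cmult_right')
  show "inner x y = Re (cinner x y)"
    by (simp add: cinner_hsum_def inner_hsum_def infsum_Re[symmetric] summable_cinner
        inner_eq_Re_cinner)
qed

end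

text \<open>The sum of the copies of \<open>'e\<close> indexed by \<open>I\<close> is regarded as a subspace of
  \<open>('i, 'e) hsum\<close>.\<close>

definition supported_on :: "'i set \<Rightarrow> ('i, 'e::complex_hilbert) hsum set" where
  "supported_on I = {x. \<forall>i. i \<notin> I \<longrightarrow> x $$ i = 0}"

definition hsingle :: "'i \<Rightarrow> 'e::complex_hilbert \<Rightarrow> ('i, 'e) hsum" where
  "hsingle i x = Abs_hsum (\<lambda>j. if j = i then x else 0)"

text \<open>Operator on the sum over the finite index set \<open>I\<close> with block matrix \<open>M\<close>, extended by zero
  to the orthogonal complement of \<^term>\<open>supported_on I\<close>.\<close>

definition block_op ::
    "'i set \<Rightarrow> ('i \<Rightarrow> 'i \<Rightarrow> 'e \<Rightarrow> 'e) \<Rightarrow> ('i, 'e::complex_hilbert) hsum \<Rightarrow> ('i, 'e) hsum" where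
  "block_op I M x = Abs_hsum (\<lambda>i. if i \<in> I then \<Sum>j\<in>I. M i j (x $$ j) else 0)"

definition entry :: "(('i, 'e) hsum \<Rightarrow> ('i, 'e) hsum) \<Rightarrow> 'i \<Rightarrow> 'i \<Rightarrow> 'e \<Rightarrow> 'e::complex_hilbert"
  where "entry T i j = (\<lambda>x. T (hsingle j x) $$ i)"

definition row_op ::
    "('i \<Rightarrow> 'e \<Rightarrow> 'g) \<Rightarrow> ('i, 'e::complex_hilbert) hsum \<Rightarrow> 'g::complex_hilbert" where
  "row_op R x = (\<Sum>\<^sub>\<infinity>i. R i (x $$ i))"

section \<open>Upper triangular operators on the Fock space\<close>

text \<open>The letters form a finite type \<open>'n\<close>, so \<open>N = CARD('n)\<close>; words are lists.
  The space \<open>\<E>\<^sub>k\<close> is \<^term>\<open>supported_on {\<sigma> :: 'n list. length \<sigma> = k}\<close>, and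
  the sum of all \<open>\<E>\<^sub>k\<close> is \<open>('n, 'e) fock\<close>.\<close>

type_synonym ('n, 'e) fock = "('n list, 'e) hsum"

definition Z_ball :: "('n::finite \<Rightarrow> 'e \<Rightarrow> 'e::complex_hilbert) set" where
  "Z_ball = {Z. (\<forall>k. bounded_clinear (Z k)) \<and>
     (let A = (\<lambda>x. x - (\<Sum>k\<in>UNIV. (Z k)\<dagger> (Z k x)))
      in positive_on UNIV A \<and> boundedly_invertible A)}"

fun word_op :: "('n \<Rightarrow> 'g \<Rightarrow> 'g) \<Rightarrow> 'n list \<Rightarrow> 'g \<Rightarrow> 'g" where
  "word_op F [] = id"
| "word_op F (i # \<sigma>) = F i \<circ> word_op F \<sigma>"

text \<open>The \<open>N\<close>-fold direct sum of a matrix indexed by words; the new outermost summand index is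
  the first letter. Only the entries at nonempty words are relevant.\<close>

fun ampliation :: "('n list \<Rightarrow> 'n list \<Rightarrow> 'e \<Rightarrow> 'e) \<Rightarrow> 'n list \<Rightarrow> 'n list \<Rightarrow> 'e \<Rightarrow> 'e::complex_hilbert"
  where
  "ampliation M (a # \<sigma>) (b # \<tau>) = (if a = b then M \<sigma> \<tau> else (\<lambda>_. 0))"
| "ampliation M _ _ = (\<lambda>_. 0)"

definition UT :: "(('n::finite, 'e::complex_hilbert) fock \<Rightarrow> ('n, 'e) fock) set" where
  "UT = {T. bounded_clinear T \<and>
     (\<forall>\<sigma> \<tau>. length \<tau> < length \<sigma> \<longrightarrow> entry T \<sigma> \<tau> = (\<lambda>_. 0)) \<and>
     (\<forall>\<sigma> \<tau>. 1 \<le> length \<sigma> \<and> length \<sigma> \<le> length \<tau> \<longrightarrow>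
       entry T \<sigma> \<tau> = ampliation (entry T) \<sigma> \<tau>)}"

definition Schur :: "(('n::finite, 'e::complex_hilbert) fock \<Rightarrow> ('n, 'e) fock) set" where
  "Schur = {T \<in> UT. \<forall>x. norm (T x) \<le> norm x}"

section \<open>Derivatives\<close>

text \<open>Entries of the infinite lower triangular matrix \<open>[X\<^sub>i\<^sub>j]\<close> whose truncations are
  \<open>F\<^sub>k\<^sup>(\<^sup>l\<^sup>)\<close>: the second equation combines \<open>X\<^sub>1\<^sub>0 = E\<^sub>k\<close> and \<open>X\<^sub>i\<^sub>0 = 0\<close> for \<open>i > 1\<close>;
  the last one is \<open>X\<^sub>i\<^sub>j = X\<^sub>i\<^sub>-\<^sub>1\<^sub>,\<^sub>j\<^sub>-\<^sub>1\<^sup>\<oplus>\<^sup>N\<close>.\<close>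

fun F_entry :: "('n \<Rightarrow> 'e \<Rightarrow> 'e) \<Rightarrow> 'n \<Rightarrow> 'n list \<Rightarrow> 'n list \<Rightarrow> 'e \<Rightarrow> 'e::complex_hilbert" where
  "F_entry Z k [] [] = (Z k)\<dagger>"
| "F_entry Z k (a # \<sigma>) [] = (if a = k \<and> \<sigma> = [] then id else (\<lambda>_. 0))"
| "F_entry Z k [] (b # \<tau>) = (\<lambda>_. 0)"
| "F_entry Z k (a # \<sigma>) (b # \<tau>) = (if a = b then F_entry Z k \<sigma> \<tau> else (\<lambda>_. 0))"

definition F_op :: "nat \<Rightarrow> ('n::finite \<Rightarrow> 'e \<Rightarrow> 'e) \<Rightarrow> 'n \<Rightarrow>
    ('n, 'e::complex_hilbert) fock \<Rightarrow> ('n, 'e) fock" where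
  "F_op l Z k = block_op {\<sigma>. length \<sigma> \<le> l} (F_entry Z k)"

text \<open>The operator \<open>L(\<tau>, Z)\<close>, with the truncation order \<open>l = |\<tau>|\<close>.\<close>

definition L_op :: "'n::finite list \<Rightarrow> ('n \<Rightarrow> 'e \<Rightarrow> 'e) \<Rightarrow>
    ('n, 'e::complex_hilbert) fock \<Rightarrow> 'e" where
  "L_op \<tau> Z x = row_op (\<lambda>\<sigma>. word_op (F_op (length \<tau>) Z) \<sigma> \<circ> hsingle []) x $$ \<tau>"

definition partial_deriv :: "'n::finite list \<Rightarrow>
    (('n, 'e::complex_hilbert) fock \<Rightarrow> ('n, 'e) fock) \<Rightarrow> ('n \<Rightarrow> 'e \<Rightarrow> 'e) \<Rightarrow> 'e \<Rightarrow> 'e" where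
  "partial_deriv \<tau> T Z x = T ((L_op \<tau> Z)\<dagger> x) $$ []"

text \<open>For \<open>k = 0\<close> this is the value \<open>T(Z)\<close>.\<close>

definition total_deriv :: "nat \<Rightarrow>
    (('n::finite, 'e::complex_hilbert) fock \<Rightarrow> ('n, 'e) fock) \<Rightarrow> ('n \<Rightarrow> 'e \<Rightarrow> 'e) \<Rightarrow> 'e \<Rightarrow> 'e" where
  "total_deriv k T Z x = (\<Sum>\<sigma> | length \<sigma> = k. partial_deriv \<sigma> T Z x)"

section \<open>Interpolation data\<close>

text \<open>The space \<open>\<E>\<^sup>\<oplus>\<^sup>(\<^sup>l\<^sup>+\<^sup>1\<^sup>)\<close> is \<^term>\<open>supported_on {..l::nat}\<close>.\<close>

definition Ft_op :: "nat \<Rightarrow> ('n \<Rightarrow> 'e \<Rightarrow> 'e) \<Rightarrow> 'n \<Rightarrow>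
    (nat, 'e::complex_hilbert) hsum \<Rightarrow> (nat, 'e) hsum" where
  "Ft_op l Z k = block_op {..l}
     (\<lambda>i j. if i = j then (Z k)\<dagger> else if i = Suc j then id else (\<lambda>_. 0))"

definition U_col :: "'e::complex_hilbert \<Rightarrow> (nat, 'e) hsum" where
  "U_col = (row_op (\<lambda>k. if k = 0 then id else (\<lambda>_. 0)))\<dagger>"

definition V_col :: "nat \<Rightarrow> (nat \<Rightarrow> 'e \<Rightarrow> 'e) \<Rightarrow> 'e::complex_hilbert \<Rightarrow> (nat, 'e) hsum" where
  "V_col l B = (row_op (\<lambda>k. if k \<le> l then B k else (\<lambda>_. 0)))\<dagger>"

definition U_inf :: "nat \<Rightarrow> ('n::finite \<Rightarrow> 'e \<Rightarrow> 'e) \<Rightarrow>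
    (nat, 'e::complex_hilbert) hsum \<Rightarrow> ('n, 'e) fock" where
  "U_inf l Z = (row_op (\<lambda>\<sigma>. word_op (Ft_op l Z) \<sigma> \<circ> U_col))\<dagger>"

definition V_inf :: "nat \<Rightarrow> ('n::finite \<Rightarrow> 'e \<Rightarrow> 'e) \<Rightarrow> (nat \<Rightarrow> 'e \<Rightarrow> 'e) \<Rightarrow>
    (nat, 'e::complex_hilbert) hsum \<Rightarrow> ('n, 'e) fock" where
  "V_inf l Z B = (row_op (\<lambda>\<sigma>. word_op (Ft_op l Z) \<sigma> \<circ> V_col l B))\<dagger>"

end

theory Submission
  imports Defs
begin

text \<open>
  Write \<open>G\<^sub>a\<close> for the adjoint of \<^term>\<open>Ft_op l Z a\<close>. Membership in \<open>\<U>\<^sub>\<T>\<close> means commuting with the backward shifts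
  \<open>S\<^sub>a\<close>, \<open>(S\<^sub>a y)\<^sub>\<sigma> = y\<^bsub>a\<sigma>\<^esub>\<close>, and \<open>U\<^sub>\<infinity>\<close>, \<open>V\<^sub>\<infinity>\<close> intertwine \<open>G\<^sub>a\<close> with \<open>S\<^sub>a\<close>. Since \<open>D\<^sup>kT\<^sub>Z x\<close> is the root
  component of \<open>T U\<^sub>\<infinity>\<close> at \<open>x\<close> in the \<open>k\<close>th summand, and \<open>B\<^sub>k x\<close> that of \<open>V\<^sub>\<infinity>\<close>, the interpolation conditions say
  \<open>T U\<^sub>\<infinity> = V\<^sub>\<infinity>\<close>; this gives necessity. Conversely, if \<open>U\<^sub>\<infinity>\<^sup>*U\<^sub>\<infinity> - V\<^sub>\<infinity>\<^sup>*V\<^sub>\<infinity> = R\<^sup>2\<close>, then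
  \<open>\<parallel>R x\<parallel>\<^sup>2 + \<parallel>V\<^sup>*x\<parallel>\<^sup>2 = \<Sum>\<^sub>a \<parallel>R G\<^sub>a x\<parallel>\<^sup>2 + \<parallel>U\<^sup>*x\<parallel>\<^sup>2\<close>, and a contraction \<open>W\<close> mapping \<open>((R G\<^sub>a x)\<^sub>a, U\<^sup>*x)\<close> to
  \<open>(R x, V\<^sup>*x)\<close> is the colligation of a system whose transfer operator is the required \<open>T\<close>.
\<close>

section \<open>Bounded operators on complex Hilbert spaces\<close>

instance complex_hilbert \<subseteq> banach ..

lemma bounded_clinearI:
  assumes "\<And>x y. A (x + y) = A x + A y" "\<And>c x. A (c *\<^sub>C x) = c *\<^sub>C A x"
    and "\<And>x. norm (A x) \<le> K * norm x"
  shows "bounded_clinear A"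
  unfolding bounded_clinear_def
proof (intro conjI allI)
  show "bounded_linear A"
    by (rule bounded_linear_intro[where K=K])
      (use assms in \<open>auto simp: scaleR_scaleC mult.commute\<close>)
qed (use assms in auto)

lemma bounded_clinear_linear: "bounded_clinear A \<Longrightarrow> bounded_linear A"
  by (simp add: bounded_clinear_def)

lemma bounded_clinear_scaleC: "bounded_clinear A \<Longrightarrow> A (c *\<^sub>C x) = c *\<^sub>C A x"
  by (simp add: bounded_clinear_def)

lemma bounded_clinear_add: "bounded_clinear A \<Longrightarrow> A (x + y) = A x + A y"
  by (simp add: bounded_clinear_def linear_simps)

lemma bounded_clinear_zero: "bounded_clinear A \<Longrightarrow> A 0 = 0"
  by (simp add: bounded_clinear_def linear_simps)

lemma bounded_clinear_diff: "bounded_clinear A \<Longrightarrow> A (x - y) = A x - A y"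
  by (simp add: bounded_clinear_def linear_simps)

lemma bounded_clinear_sum: "bounded_clinear A \<Longrightarrow> A (\<Sum>i\<in>I. f i) = (\<Sum>i\<in>I. A (f i))"
  using bounded_clinear_linear bounded_linear.linear linear_sum by blast

lemma bounded_clinear_bound:
  assumes "bounded_clinear A"
  obtains K where "K > 0" "\<And>x. norm (A x) \<le> K * norm x"
  using bounded_linear.pos_bounded[OF bounded_clinear_linear[OF assms]] by (auto simp: mult.commute)

lemma bounded_clinear_compose:
  "bounded_clinear A \<Longrightarrow> bounded_clinear B \<Longrightarrow> bounded_clinear (\<lambda>x. A (B x))"
  unfolding bounded_clinear_def by (auto intro: bounded_linear_compose)

lemma scaleC_zero_right [simp]: "c *\<^sub>C 0 = (0::'a::complex_hilbert)"
  using scaleC_add_right[of c 0 "0::'a"] by simp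

lemma scaleC_minus_right: "c *\<^sub>C (- x) = - (c *\<^sub>C (x::'a::complex_hilbert))"
  using scaleC_add_right[of c x "- x"] by (simp add: eq_neg_iff_add_eq_0 add.commute)

lemma scaleC_diff_right: "c *\<^sub>C (x - y) = c *\<^sub>C x - c *\<^sub>C (y::'a::complex_hilbert)"
  using scaleC_add_right[of c x "- y"] by (simp add: scaleC_minus_right)

lemma scaleC_sum_right: "c *\<^sub>C (\<Sum>i\<in>I. f i) = (\<Sum>i\<in>I. c *\<^sub>C (f i::'a::complex_hilbert))"
  by (induction I rule: infinite_finite_induct) (auto simp: scaleC_add_right)

lemma bounded_clinear_minus:
  "bounded_clinear A \<Longrightarrow> bounded_clinear B \<Longrightarrow> bounded_clinear (\<lambda>x. A x - B x)"
  unfolding bounded_clinear_def by (auto intro: bounded_linear_sub simp: scaleC_diff_right)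

lemma bounded_clinear_setsum:
  "(\<And>i. i \<in> I \<Longrightarrow> bounded_clinear (A i)) \<Longrightarrow> bounded_clinear (\<lambda>x. \<Sum>i\<in>I. A i x)"
  unfolding bounded_clinear_def by (auto intro: bounded_linear_sum simp: scaleC_sum_right)

lemma bounded_clinear_id: "bounded_clinear (\<lambda>x. x)"
  by (simp add: bounded_clinear_def)

lemma bounded_clinear_const_zero: "bounded_clinear (\<lambda>_. 0)"
  by (simp add: bounded_clinear_def)

lemma bounded_linear_scaleC: "bounded_linear (\<lambda>x. c *\<^sub>C (x::'a::complex_hilbert))"
  by (rule bounded_linear_intro[where K="cmod c"])
    (auto simp: scaleC_add_right scaleR_scaleC scaleC_scaleC norm_scaleC mult.commute)

text \<open>The imaginary part of \<open>cinner x y\<close> is the real part of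
  \<open>cinner ((- \<i>) *\<^sub>C x) y\<close>, so identities of real inner products for all
  complex multiples lift to complex ones.\<close>

lemma cinner_eq_iff_inner:
  assumes "\<And>c. inner (c *\<^sub>C (x::'a::complex_hilbert)) y = inner (c *\<^sub>C (x'::'b::complex_hilbert)) y'"
  shows "cinner x y = cinner x' y'"
  using assms[of 1] assms[of "- \<i>"]
  by (auto simp: inner_eq_Re_cinner cinner_scaleC_left complex_eq_iff)

lemma inner_scaleC_left: "inner (c *\<^sub>C x) y = inner x (cnj c *\<^sub>C (y::'a::complex_hilbert))"
  by (simp add: inner_eq_Re_cinner cinner_scaleC_left cinner_scaleC_right)

lemma cinner_zero_left [simp]: "cinner 0 (x::'a::complex_hilbert) = 0"
  using cinner_add_left[of 0 0 x] by simp

lemma cinner_zero_right [simp]: "cinner (x::'a::complex_hilbert) 0 = 0"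
  using cinner_add_right[of x 0 0] by simp

lemma cinner_diff_left: "cinner (x - y) (z::'a::complex_hilbert) = cinner x z - cinner y z"
  using cinner_add_left[of "x - y" y z] by simp

lemma cinner_sum_left: "cinner (\<Sum>i\<in>I. f i) (x::'a::complex_hilbert) = (\<Sum>i\<in>I. cinner (f i) x)"
  by (induction I rule: infinite_finite_induct) (auto simp: cinner_add_left)

lemma cinner_sum_right: "cinner (x::'a::complex_hilbert) (\<Sum>i\<in>I. f i) = (\<Sum>i\<in>I. cinner x (f i))"
  by (induction I rule: infinite_finite_induct) (auto simp: cinner_add_right)

lemma eq_if_inner_eq: "(\<And>z. inner x z = inner y z) \<Longrightarrow> x = (y::'a::real_inner)"
  using inner_eq_zero_iff[of "x - y"] by (simp add: inner_diff_left)

lemma eq_if_cinner_eq: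
  assumes "\<And>z. cinner z x = cinner z y"
  shows "x = (y::'a::complex_hilbert)"
proof (rule eq_if_inner_eq)
  show "inner x z = inner y z" for z
    using arg_cong[OF assms[of z], of Re] unfolding inner_eq_Re_cinner[symmetric]
    by (simp add: inner_commute)
qed

section \<open>Riesz representation and Douglas factorisation\<close>

lemma closure_limI: "\<forall>n. f n \<in> S \<Longrightarrow> f \<longlonglongrightarrow> w \<Longrightarrow> w \<in> closure (S :: 'a::metric_space set)"
  unfolding closure_sequential by blast

lemma closure_limD:
  "w \<in> closure (S :: 'a::metric_space set) \<Longrightarrow> \<exists>f. (\<forall>n. f n \<in> S) \<and> f \<longlonglongrightarrow> w"
  unfolding closure_sequential .

text \<open>The representing vector is the limit of \<open>P x\<close> along a sequence minimising
  \<open>\<parallel>P x\<parallel>\<^sup>2 - 2 \<psi> x\<close>.\<close>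

lemma riesz_through:
  fixes P :: "'x::real_vector \<Rightarrow> 'a::{real_inner,complete_space}" and \<psi> :: "'x \<Rightarrow> real"
  assumes P: "linear P" and \<psi>: "linear \<psi>" and bound: "\<And>x. \<psi> x \<le> C * norm (P x)"
  shows "\<exists>w\<in>closure (range P). \<forall>x. \<psi> x = inner (P x) w"
proof -
  define J where "J x = (norm (P x))\<^sup>2 - 2 * \<psi> x" for x
  define m where "m = Inf (range J)"
  have "- (C\<^sup>2) \<le> J x" for x
  proof -
    have "0 \<le> (norm (P x) - C)\<^sup>2" by simp
    then show ?thesis
      using bound[of x] by (simp add: J_def power2_eq_square algebra_simps)
  qed
  then have bdd: "bdd_below (range J)" by (auto intro!: bdd_belowI)
  then have m_le: "m \<le> J x" for x
    unfolding m_def by (auto intro: cInf_lower)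
  have "\<exists>x. J x < m + 1 / real (Suc n)" for n
    using cInf_less_iff[of "range J" "m + 1 / real (Suc n)"] bdd
    by (auto simp: m_def[symmetric])
  then obtain x where x: "\<And>n. J (x n) < m + 1 / real (Suc n)" by metis
  \<comment> \<open>The parallelogram law, with \<open>m\<close> as a lower bound for
    \<open>J\<close> at the midpoint \<open>c\<close>. It makes \<open>P x\<close> Cauchy along a
    minimising sequence.\<close>
  have diff: "(norm (P a - P b))\<^sup>2 \<le> 2 * J a + 2 * J b - 4 * m" for a b
  proof -
    define c where "c = (1/2) *\<^sub>R (a + b)"
    have "(norm (P a - P b))\<^sup>2 = 2 * J a + 2 * J b - 4 * J c"
      unfolding J_def c_def power2_norm_eq_inner linear_scale[OF P] linear_add[OF P]
        linear_scale[OF \<psi>] linear_add[OF \<psi>]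
      by (simp add: algebra_simps inner_commute)
    then show ?thesis using m_le[of c] by linarith
  qed
  have "Cauchy (\<lambda>n. P (x n))"
  proof (rule metric_CauchyI)
    fix e :: real assume e: "e > 0"
    obtain M where M: "1 / real (Suc M) < e\<^sup>2 / 4"
      using nat_approx_posE[of "e\<^sup>2 / 4"] e by auto
    have small: "J (x k) - m < e\<^sup>2 / 4" if "k \<ge> M" for k
    proof -
      have "1 / real (Suc k) \<le> 1 / real (Suc M)"
        using that by (simp add: frac_le)
      then show ?thesis using x[of k] M by linarith
    qed
    show "\<exists>M. \<forall>i\<ge>M. \<forall>j\<ge>M. dist (P (x i)) (P (x j)) < e"
    proof (intro exI[of _ M] allI impI)
      fix i j assume "M \<le> i" "M \<le> j"
      then have "(norm (P (x i) - P (x j)))\<^sup>2 < e\<^sup>2"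
        using diff[of "x i" "x j"] small[of i] small[of j] by linarith
      then show "dist (P (x i)) (P (x j)) < e"
        using e by (simp add: dist_norm power2_less_imp_less)
    qed
  qed
  then obtain w where w: "(\<lambda>n. P (x n)) \<longlonglongrightarrow> w"
    by (auto simp: Cauchy_convergent_iff convergent_def)
  have Jlim: "(\<lambda>n. J (x n)) \<longlonglongrightarrow> m"
  proof (rule tendsto_sandwich[where f="\<lambda>_. m"])
    show "(\<lambda>n. m + 1 / real (Suc n)) \<longlonglongrightarrow> m"
      using tendsto_add[OF tendsto_const LIMSEQ_inverse_real_of_nat, of m] by (simp add: inverse_eq_divide)
  qed (use x m_le in \<open>auto intro!: always_eventually less_imp_le\<close>)
  have "\<psi> z = inner (P z) w" for z
  proof -
    define d where "d = inner (P z) w - \<psi> z"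
    define p where "p = (norm (P z))\<^sup>2"
    \<comment> \<open>Adding \<open>t *\<^sub>R z\<close> to the minimising sequence cannot push
      \<open>J\<close> below \<open>m\<close>; in the limit this leaves a quadratic in
      \<open>t\<close> that stays nonnegative.\<close>
    have quad: "0 \<le> 2 * t * d + t\<^sup>2 * p" for t
    proof -
      have "m \<le> J (x n) + 2 * t * (inner (P z) (P (x n)) - \<psi> z) + t\<^sup>2 * p" for n
      proof -
        have "J (x n + t *\<^sub>R z)
            = J (x n) + 2 * t * (inner (P z) (P (x n)) - \<psi> z) + t\<^sup>2 * p"
          unfolding J_def p_def power2_norm_eq_inner linear_scale[OF P] linear_add[OF P]
            linear_scale[OF \<psi>] linear_add[OF \<psi>]
          by (simp add: algebra_simps inner_commute power2_eq_square)
        then show ?thesis using m_le[of "x n + t *\<^sub>R z"] by simp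
      qed
      moreover have "(\<lambda>n. J (x n) + 2 * t * (inner (P z) (P (x n)) - \<psi> z) + t\<^sup>2 * p)
          \<longlonglongrightarrow> m + 2 * t * (inner (P z) w - \<psi> z) + t\<^sup>2 * p"
        by (intro tendsto_intros Jlim w)
      ultimately have "m \<le> m + 2 * t * (inner (P z) w - \<psi> z) + t\<^sup>2 * p"
        by (intro LIMSEQ_le_const) auto
      then show ?thesis by (simp add: d_def)
    qed
    have p: "p \<ge> 0" by (simp add: p_def)
    \<comment> \<open>This \<open>t\<close> is nearly the minimiser of the quadratic;
      \<open>1 + p\<close> replaces \<open>p\<close> in the denominator so that \<open>p = 0\<close>
      needs no separate case.\<close>
    have "0 \<le> 2 * (- d / (1 + p)) * d + (- d / (1 + p))\<^sup>2 * p" by (rule quad)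
    also have "\<dots> = (d / (1 + p))\<^sup>2 * (- 2 - p)"
      using p by (simp add: divide_simps power2_eq_square) (simp add: algebra_simps)
    finally have "(d / (1 + p))\<^sup>2 \<le> 0"
      using p by (simp add: zero_le_mult_iff)
    then show ?thesis using p by (auto simp: d_def)
  qed
  moreover have "w \<in> closure (range P)"
    by (rule closure_limI[OF _ w]) simp
  ultimately show ?thesis by blast
qed

lemma subspace_closure:
  assumes "subspace (S :: 'a::real_normed_vector set)"
  shows "subspace (closure S)"
proof (rule subspaceI)
  show "0 \<in> closure S"
    using subspace_0[OF assms] closure_subset by blast
  fix x y assume "x \<in> closure S" "y \<in> closure S"
  obtain f where f: "\<forall>n. f n \<in> S" "f \<longlonglongrightarrow> x"
    using closure_limD[OF \<open>x \<in> closure S\<close>] by blast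
  obtain g where g: "\<forall>n. g n \<in> S" "g \<longlonglongrightarrow> y"
    using closure_limD[OF \<open>y \<in> closure S\<close>] by blast
  have "\<forall>n. f n + g n \<in> S" "(\<lambda>n. f n + g n) \<longlonglongrightarrow> x + y"
    using f g by (auto intro: subspace_add[OF assms] tendsto_add)
  then show "x + y \<in> closure S"
    by (rule closure_limI)
next
  fix x c assume x: "x \<in> closure S"
  obtain f where f: "\<forall>n. f n \<in> S" "f \<longlonglongrightarrow> x"
    using closure_limD[OF x] by blast
  have "\<forall>n. c *\<^sub>R f n \<in> S" "(\<lambda>n. c *\<^sub>R f n) \<longlonglongrightarrow> c *\<^sub>R x"
    using f by (auto intro: subspace_scale[OF assms] tendsto_scaleR)
  then show "c *\<^sub>R x \<in> closure S"
    by (rule closure_limI)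
qed

text \<open>The adjoint form of Douglas' factorisation lemma: \<open>V\<close> is the adjoint of the operator taking
  \<open>P x\<close> to \<open>Q x\<close>. The case \<open>P = id\<close> yields the adjoint of \<open>Q\<close>.\<close>

lemma douglas_adjoint:
  fixes P :: "'x::complex_hilbert \<Rightarrow> 'a::complex_hilbert" and Q :: "'x \<Rightarrow> 'b::complex_hilbert"
  assumes P: "bounded_clinear P" and Q: "bounded_clinear Q"
    and K: "0 \<le> K" and bound: "\<And>x. norm (Q x) \<le> K * norm (P x)"
  shows "\<exists>V. bounded_clinear V \<and> (\<forall>x y. cinner (Q x) y = cinner (P x) (V y)) \<and>
    (\<forall>y. norm (V y) \<le> K * norm y)"
proof -
  have "\<exists>w\<in>closure (range P). \<forall>x. inner (Q x) y = inner (P x) w" for y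
  proof (rule riesz_through[where C="K * norm y"])
    show "linear P" using P by (simp add: bounded_clinear_def bounded_linear.linear)
    show "linear (\<lambda>x. inner (Q x) y)"
      using bounded_linear_compose[OF bounded_linear_inner_left bounded_clinear_linear[OF Q]]
      by (rule bounded_linear.linear)
    fix x
    have "inner (Q x) y \<le> norm (Q x) * norm y" by (rule norm_cauchy_schwarz)
    also have "\<dots> \<le> K * norm (P x) * norm y" by (intro mult_right_mono bound) auto
    finally show "inner (Q x) y \<le> K * norm y * norm (P x)" by (simp add: mult_ac)
  qed
  then obtain V where Vcl: "\<And>y. V y \<in> closure (range P)"
    and V: "\<And>x y. inner (Q x) y = inner (P x) (V y)" by metis
  have sub: "subspace (closure (range P))"
    using P by (intro subspace_closure linear_subspace_image subspace_UNIV)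
      (simp add: bounded_clinear_def bounded_linear.linear)
  \<comment> \<open>\<open>subspace_closure\<close> speaks of real scalars only; complex ones need
    this separate argument.\<close>
  have clC: "c *\<^sub>C w \<in> closure (range P)" if w: "w \<in> closure (range P)" for c w
  proof -
    obtain f where f: "\<forall>n. f n \<in> range P" "f \<longlonglongrightarrow> w"
      using closure_limD[OF w] by blast
    have "(\<lambda>n. c *\<^sub>C f n) \<longlonglongrightarrow> c *\<^sub>C w"
      by (rule bounded_linear.tendsto[OF bounded_linear_scaleC f(2)])
    moreover have "\<forall>n. c *\<^sub>C f n \<in> range P"
      proof
      fix n
      obtain x where "f n = P x" using f(1) by blast
      then show "c *\<^sub>C f n \<in> range P" by (simp flip: bounded_clinear_scaleC[OF P])
    qed
    ultimately show ?thesis by (rule closure_limI[rotated])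
  qed
  \<comment> \<open>Inside the closure of the range of \<open>P\<close>, the relation
    \<open>inner (Q x) y = inner (P x) (V y)\<close> for all \<open>x\<close> determines
    \<open>V y\<close>. Additivity and homogeneity of \<open>V\<close> follow, although
    \<open>V y\<close> was obtained by mere choice.\<close>
  have orth: "w = 0" if w: "w \<in> closure (range P)" and 0: "\<And>x. inner (P x) w = 0" for w
  proof -
    obtain f where f: "\<forall>n. f n \<in> range P" "f \<longlonglongrightarrow> w"
      using closure_limD[OF w] by blast
    have "(\<lambda>n. inner (f n) w) \<longlonglongrightarrow> inner w w" by (intro tendsto_intros f)
    moreover have "inner (f n) w = 0" for n using spec[OF f(1), of n] 0 by auto
    ultimately show ?thesis by (simp add: LIMSEQ_const_iff)
  qed
  have add: "V (y + z) = V y + V z" for y z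
  proof -
    have "V (y + z) - (V y + V z) = 0"
    proof (rule orth)
      show "V (y + z) - (V y + V z) \<in> closure (range P)"
        by (intro subspace_diff subspace_add sub Vcl)
      show "inner (P x) (V (y + z) - (V y + V z)) = 0" for x
        unfolding inner_diff_right inner_add_right V[symmetric] by simp
    qed
    then show ?thesis by simp
  qed
  have hom: "V (c *\<^sub>C y) = c *\<^sub>C V y" for c y
  proof -
    have "inner (P x) (V (c *\<^sub>C y)) = inner (P x) (c *\<^sub>C V y)" for x
      using inner_scaleC_left[of "cnj c" "Q x" y] inner_scaleC_left[of "cnj c" "P x" "V y"]
        V[of "cnj c *\<^sub>C x" y] V[of x "c *\<^sub>C y"]
      by (simp add: bounded_clinear_scaleC[OF P] bounded_clinear_scaleC[OF Q])
    then have "V (c *\<^sub>C y) - c *\<^sub>C V y = 0"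
      by (intro orth subspace_diff sub Vcl clC) (simp add: inner_diff_right)
    then show ?thesis by simp
  qed
  \<comment> \<open>\<open>V y\<close> is a limit of vectors \<open>P x\<close>, so its inner
    product with itself can be estimated through the bound on \<open>Q x\<close>.\<close>
  have nrm: "norm (V y) \<le> K * norm y" for y
  proof -
    obtain f where f: "\<forall>n. f n \<in> range P" "f \<longlonglongrightarrow> V y"
      using closure_limD[OF Vcl[of y]] by blast
    have "inner (f n) (V y) \<le> K * norm (f n) * norm y" for n
    proof -
      obtain x where x: "f n = P x" using f(1) by blast
      have "inner (Q x) y \<le> norm (Q x) * norm y" by (rule norm_cauchy_schwarz)
      also have "\<dots> \<le> K * norm (P x) * norm y" by (intro mult_right_mono bound) auto
      finally show ?thesis by (simp add: x V)
    qed
    then have "inner (V y) (V y) \<le> K * norm (V y) * norm y"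
      by (intro LIMSEQ_le[of "\<lambda>n. inner (f n) (V y)" _ "\<lambda>n. K * norm (f n) * norm y"]
          tendsto_intros f) auto
    then have "norm (V y) * norm (V y) \<le> norm (V y) * (K * norm y)"
      by (simp add: power2_norm_eq_inner[symmetric] power2_eq_square mult_ac)
    moreover have "0 \<le> K * norm y" using K by simp
    ultimately show ?thesis
      by (cases "V y = 0") (auto simp: mult_le_cancel_left)
  qed
  have "cinner (Q x) y = cinner (P x) (V y)" for x y
    by (rule cinner_eq_iff_inner)
      (simp add: V bounded_clinear_scaleC[OF P, symmetric] bounded_clinear_scaleC[OF Q, symmetric])
  then show ?thesis
    using bounded_clinearI[OF add hom nrm] nrm by blast
qed

lemma cadjoint_eqI:
  assumes "\<And>x y. cinner (A x) y = cinner x (B y)"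
  shows "A\<dagger> = B"
  unfolding cadjoint_def
proof (rule the_equality)
  fix B' assume B': "\<forall>x y. cinner (A x) y = cinner x (B' y)"
  show "B' = B"
  proof
    fix y
    have "cinner z (B' y) = cinner z (B y)" for z
      by (rule trans[OF sym[OF spec[OF spec[OF B', of z], of y]] assms])
    then show "B' y = B y" by (rule eq_if_cinner_eq)
  qed
qed (use assms in simp)

lemma cadjoint_exists:
  assumes "bounded_clinear A"
  shows "\<exists>B. bounded_clinear B \<and> (\<forall>x y. cinner (A x) y = cinner x (B y))"
proof -
  obtain K where K: "K > 0" "\<And>x. norm (A x) \<le> K * norm x"
    using bounded_clinear_bound[OF assms] by blast
  show ?thesis
    using douglas_adjoint[OF bounded_clinear_id assms less_imp_le[OF K(1)] K(2)] by blast
qed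

lemma
  assumes "bounded_clinear A"
  shows bounded_clinear_cadjoint: "bounded_clinear (A\<dagger>)"
    and cinner_cadjoint: "cinner (A x) y = cinner x (A\<dagger> y)"
proof -
  obtain B where B: "bounded_clinear B" "\<forall>x y. cinner (A x) y = cinner x (B y)"
    using cadjoint_exists[OF assms] by blast
  then have "A\<dagger> = B" by (intro cadjoint_eqI) blast
  then show "bounded_clinear (A\<dagger>)" "cinner (A x) y = cinner x (A\<dagger> y)"
    using B by auto
qed

lemma cadjoint_swap:
  assumes "\<And>x y. cinner (A x) y = cinner x (B y)"
  shows "cinner (B y) x = cinner y (A x)"
  unfolding cinner_commute[of "B y"] cinner_commute[of y] assms ..

lemma cinner_cadjoint': "bounded_clinear A \<Longrightarrow> cinner (A\<dagger> y) x = cinner y (A x)"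
  by (rule cadjoint_swap) (rule cinner_cadjoint)

lemma cadjoint_cadjoint: "bounded_clinear A \<Longrightarrow> A\<dagger>\<dagger> = A"
  by (rule cadjoint_eqI) (rule cinner_cadjoint')

lemma norm_adjoint_le:
  assumes "\<And>x y. cinner (A x) y = cinner x (B y)"
    and "0 \<le> K" and "\<And>x. norm (A x) \<le> K * norm x"
  shows "norm (B y) \<le> K * norm y"
proof (cases "B y = 0")
  case False
  have "norm (B y) * norm (B y) = inner (A (B y)) y"
    by (simp add: inner_eq_Re_cinner assms(1) cinner_self power2_eq_square)
  also have "\<dots> \<le> norm (A (B y)) * norm y" by (rule norm_cauchy_schwarz)
  also have "\<dots> \<le> K * norm (B y) * norm y" by (intro mult_right_mono assms) auto
  finally show ?thesis using False by (simp add: mult_ac mult_le_cancel_left)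
qed (use assms in simp)

section \<open>Square roots of positive operators\<close>

text \<open>\<open>inner (A x) y\<close> is a possibly degenerate inner product; nonnegativity of
  its quadratic form on the span of \<open>x\<close> and \<open>y\<close> gives the discriminant
  inequality.\<close>

lemma positive_operator_cauchy_schwarz:
  fixes A :: "'a::real_inner \<Rightarrow> 'a"
  assumes A: "linear A" and sym: "\<And>x y. inner (A x) y = inner x (A y)"
    and pos: "\<And>x. 0 \<le> inner (A x) x"
  shows "(inner (A x) y)\<^sup>2 \<le> inner (A x) x * inner (A y) y"
proof -
  define p where "p = inner (A x) x"
  define q where "q = inner (A y) y"
  define r where "r = inner (A x) y"
  have e: "inner (A y) x = r"
    unfolding r_def by (subst sym) (rule inner_commute)
  have quad: "0 \<le> s\<^sup>2 * p + 2 * s * t * r + t\<^sup>2 * q" for s t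
  proof -
    have "inner (A (s *\<^sub>R x + t *\<^sub>R y)) (s *\<^sub>R x + t *\<^sub>R y)
        = s\<^sup>2 * p + 2 * s * t * r + t\<^sup>2 * q"
      by (simp add: linear_add[OF A] linear_scale[OF A] inner_add_left inner_add_right e
          p_def[symmetric] q_def[symmetric] r_def[symmetric] algebra_simps power2_eq_square)
    then show ?thesis using pos[of "s *\<^sub>R x + t *\<^sub>R y"] by simp
  qed
  have pq: "p \<ge> 0" "q \<ge> 0" using pos by (auto simp: p_def q_def)
  have "r\<^sup>2 \<le> p * q"
  proof (cases "q = 0")
    case True
    show ?thesis
    proof (rule ccontr)
      assume "\<not> ?thesis"
      then have r: "r \<noteq> 0" using True by auto
      \<comment> \<open>With this \<open>t\<close>, the nonnegative expression
        \<open>p + 2 * (t * r)\<close> would equal -1.\<close>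
      define t where "t = - (p + 1) / (2 * r)"
      have "t * r = - (p + 1) / 2" using r by (simp add: t_def)
      moreover have "0 \<le> p + 2 * (t * r)" using quad[of 1 t] True by simp
      ultimately show False by simp
    qed
  next
    case False
    have "0 \<le> q\<^sup>2 * p - r\<^sup>2 * q"
      using quad[of q "- r"] by (simp add: power2_eq_square algebra_simps)
    then have "0 \<le> q * (p * q - r\<^sup>2)" by (simp add: power2_eq_square algebra_simps)
    then show ?thesis using False pq by (simp add: zero_le_mult_iff)
  qed
  then show ?thesis by (simp add: p_def q_def r_def)
qed

text \<open>Cauchy-Schwarz for the form of \<open>A\<close>, applied to \<open>x\<close> and
  \<open>A x\<close>. In operator terms, 0 \<le> A \<le> K implies that A squared is at most K
  A.\<close>

lemma positive_operator_norm_le: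
  fixes A :: "'a::real_inner \<Rightarrow> 'a"
  assumes A: "linear A" and sym: "\<And>x y. inner (A x) y = inner x (A y)"
    and pos: "\<And>x. 0 \<le> inner (A x) x" and bound: "\<And>x. inner (A x) x \<le> K * (norm x)\<^sup>2"
  shows "(norm (A x))\<^sup>2 \<le> K * inner (A x) x"
proof (cases "A x = 0")
  case False
  then have n: "0 < (norm (A x))\<^sup>2" by simp
  have "(norm (A x))\<^sup>2 * (norm (A x))\<^sup>2 = (inner (A x) (A x))\<^sup>2"
    unfolding power2_norm_eq_inner by (simp only: power2_eq_square)
  also have "\<dots> \<le> inner (A x) x * inner (A (A x)) (A x)"
    by (rule positive_operator_cauchy_schwarz[OF A sym pos])
  also have "\<dots> \<le> inner (A x) x * (K * (norm (A x))\<^sup>2)"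
    by (intro mult_left_mono bound pos)
  finally have "(norm (A x))\<^sup>2 * (norm (A x))\<^sup>2 \<le> K * inner (A x) x * (norm (A x))\<^sup>2"
    by (simp only: mult_ac)
  then show ?thesis using n by (rule mult_right_le_imp_le)
qed simp

text \<open>With \<open>X = 1 - A / K\<close>, the iteration \<open>Y \<mapsto> (X + Y\<^sup>2) / 2\<close> converges to \<open>1 - (A / K)\<^sup>1\<^sup>/\<^sup>2\<close>;
  its increments are dominated by those of the same iteration for the number 1.\<close>

lemma positive_operator_sqrt:
  fixes A :: "'a::{real_inner,banach} \<Rightarrow> 'a"
  assumes A: "bounded_linear A" and sym: "\<And>x y. inner (A x) y = inner x (A y)"
    and pos: "\<And>x. 0 \<le> inner (A x) x"
  shows "\<exists>R. bounded_linear R \<and> (\<forall>x y. inner (R x) y = inner x (R y)) \<and> (\<forall>x. R (R x) = A x) \<and>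
    (\<forall>J. bounded_linear J \<longrightarrow> (\<forall>x. A (J x) = J (A x)) \<longrightarrow> (\<forall>x. R (J x) = J (R x)))"
proof -
  obtain K where K: "K > 0" and AK: "\<And>x. norm (A x) \<le> norm x * K"
    using bounded_linear.pos_bounded[OF A] by auto
  have lin: "linear A" using A by (rule bounded_linear.linear)
  define X where "X = id_blinfun - (1 / K) *\<^sub>R Blinfun A"
  have X: "blinfun_apply X x = x - (1 / K) *\<^sub>R A x" for x
    by (simp add: X_def blinfun.diff_left blinfun.scaleR_left bounded_linear_Blinfun_apply A)
  have Aq: "inner (A x) x \<le> K * (norm x)\<^sup>2" for x
  proof -
    have "inner (A x) x \<le> norm (A x) * norm x" by (rule norm_cauchy_schwarz)
    also have "\<dots> \<le> norm x * K * norm x" by (intro mult_right_mono AK) auto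
    finally show ?thesis by (simp add: power2_eq_square mult_ac)
  qed
  \<comment> \<open>With \<open>c = 1 / K\<close>, the square of X is 1 - 2 c A plus the square of c
    A. The latter is at most c A, which leaves at most 1 - c A.\<close>
  have "norm X \<le> 1"
  proof (rule norm_blinfun_bound)
    fix x
    define c where "c = 1 / K"
    have "(norm (A x))\<^sup>2 \<le> K * inner (A x) x"
      by (rule positive_operator_norm_le[OF lin sym pos Aq])
    then have "c\<^sup>2 * (norm (A x))\<^sup>2 \<le> c\<^sup>2 * (K * inner (A x) x)"
      by (rule mult_left_mono) simp
    also have "\<dots> = c * inner (A x) x"
      using K by (simp add: c_def power2_eq_square)
    finally have "c\<^sup>2 * (norm (A x))\<^sup>2 \<le> c * inner (A x) x" .
    moreover have "0 \<le> c * inner (A x) x" using pos K by (simp add: c_def)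
    moreover have "(norm (blinfun_apply X x))\<^sup>2
        = (norm x)\<^sup>2 - 2 * (c * inner (A x) x) + c\<^sup>2 * (norm (A x))\<^sup>2"
      unfolding X c_def[symmetric] power2_norm_eq_inner
      by (simp add: inner_diff_left inner_diff_right inner_commute[of x "A x"] power2_eq_square
          right_diff_distrib)
    ultimately have "(norm (blinfun_apply X x))\<^sup>2 \<le> (norm x)\<^sup>2" by linarith
    then have "norm (blinfun_apply X x) \<le> norm x" by (rule power2_le_imp_le) simp
    then show "norm (blinfun_apply X x) \<le> 1 * norm x" by simp
  qed simp
  define Y where "Y = rec_nat (0 :: 'a \<Rightarrow>\<^sub>L 'a) (\<lambda>_ Y. (1/2) *\<^sub>R (X + (Y o\<^sub>L Y)))"
  define y where "y = rec_nat (0 :: real) (\<lambda>_ y. (1 + y\<^sup>2) / 2)"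
  have Y0: "Y 0 = 0" and YS: "Y (Suc n) = (1/2) *\<^sub>R (X + (Y n o\<^sub>L Y n))" for n
    by (simp_all add: Y_def)
  have y0: "y 0 = 0" and yS: "y (Suc n) = (1 + (y n)\<^sup>2) / 2" for n
    by (simp_all add: y_def)
  have y01: "0 \<le> y n \<and> y n \<le> 1" for n
    by (induction n) (auto simp: y0 yS power_le_one)
  have Yn: "norm (Y n) \<le> y n" for n
  proof (induction n)
    case (Suc n)
    have "norm (Y n o\<^sub>L Y n) \<le> (y n)\<^sup>2"
      using norm_blinfun_compose[of "Y n" "Y n"] mult_mono[OF Suc Suc] y01[of n]
      by (simp add: power2_eq_square)
    then have "norm (X + (Y n o\<^sub>L Y n)) \<le> 1 + (y n)\<^sup>2"
      using norm_triangle_ineq[of X "Y n o\<^sub>L Y n"] \<open>norm X \<le> 1\<close> by linarith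
    then show ?case by (simp add: YS yS)
  qed (simp add: Y0 y0)
  have diff: "norm (Y (Suc n) - Y n) \<le> y (Suc n) - y n" for n
  proof (induction n)
    case 0
    show ?case using Yn[of "Suc 0"] by (simp add: Y0 y0)
  next
    case (Suc n)
    let ?D = "Y (Suc n) - Y n" and ?d = "y (Suc n) - y n"
    \<comment> \<open>The difference of squares is split so that \<open>Y (Suc n)\<close> and
      \<open>Y n\<close> need not commute.\<close>
    have "Y (Suc (Suc n)) - Y (Suc n) = (1/2) *\<^sub>R ((?D o\<^sub>L Y (Suc n)) + (Y n o\<^sub>L ?D))"
      unfolding YS[of "Suc n"] YS[of n]
      by (rule blinfun_eqI) (simp add: blinfun.add_left blinfun.diff_left blinfun.diff_right
          blinfun.scaleR_left blinfun.add_right blinfun.scaleR_right algebra_simps)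
    also have "norm \<dots> \<le> (1/2) * (?d * y (Suc n) + y n * ?d)"
    proof -
      have "norm (?D o\<^sub>L Y (Suc n)) \<le> ?d * y (Suc n)"
        using norm_blinfun_compose[of ?D "Y (Suc n)"]
          mult_mono[OF Suc Yn[of "Suc n"]] order_trans[OF norm_ge_zero Suc] by simp
      moreover have "norm (Y n o\<^sub>L ?D) \<le> y n * ?d"
        using norm_blinfun_compose[of "Y n" ?D] mult_mono[OF Yn[of n] Suc] y01[of n] by simp
      ultimately show ?thesis
        using norm_triangle_ineq[of "?D o\<^sub>L Y (Suc n)" "Y n o\<^sub>L ?D"] by simp
    qed
    also have "\<dots> = y (Suc (Suc n)) - y (Suc n)"
      unfolding yS[of "Suc n"] yS[of n] by (simp add: algebra_simps power2_eq_square)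
    finally show ?case .
  qed
  have "incseq y"
    by (rule incseq_SucI) (use order_trans[OF norm_ge_zero diff] in simp)
  then have "convergent y"
    by (rule incseq_convergent[of y 1, THEN exE]) (auto simp: y01 convergent_def)
  then have "summable (\<lambda>n. y (Suc n) - y n)"
    using telescope_summable by (auto simp: convergent_def)
  then have "summable (\<lambda>n. Y (Suc n) - Y n)"
    by (rule summable_comparison_test'[where N=0]) (rule diff)
  then have "(\<lambda>n. \<Sum>i<n. Y (Suc i) - Y i) \<longlonglongrightarrow> (\<Sum>n. Y (Suc n) - Y n)"
    by (rule summable_LIMSEQ)
  then obtain Yi where Yi: "Y \<longlonglongrightarrow> Yi"
    by (auto simp: sum_lessThan_telescope Y0)
  have app: "(\<lambda>n. blinfun_apply (Y n) x) \<longlonglongrightarrow> blinfun_apply Yi x" for x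
    by (intro tendsto_intros Yi)
  have fixp: "Yi = (1/2) *\<^sub>R (X + (Yi o\<^sub>L Yi))"
  proof (rule LIMSEQ_unique)
    show "(\<lambda>n. Y (Suc n)) \<longlonglongrightarrow> Yi" using Yi by (rule LIMSEQ_Suc)
    show "(\<lambda>n. Y (Suc n)) \<longlonglongrightarrow> (1/2) *\<^sub>R (X + (Yi o\<^sub>L Yi))"
      unfolding YS by (intro tendsto_intros Yi bounded_bilinear.tendsto[OF bounded_bilinear_blinfun_compose])
  qed
  have Ysym: "inner (blinfun_apply (Y n) x) z = inner x (blinfun_apply (Y n) z)" for n x z
    by (induction n arbitrary: x z)
      (auto simp: Y0 YS X blinfun.add_left blinfun.scaleR_left inner_add_left inner_add_right
        inner_diff_left inner_diff_right sym)
  have Yisym: "inner (blinfun_apply Yi x) z = inner x (blinfun_apply Yi z)" for x z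
  proof (rule LIMSEQ_unique)
    show "(\<lambda>n. inner (blinfun_apply (Y n) x) z) \<longlonglongrightarrow> inner (blinfun_apply Yi x) z"
      by (intro tendsto_intros app)
    show "(\<lambda>n. inner (blinfun_apply (Y n) x) z) \<longlonglongrightarrow> inner x (blinfun_apply Yi z)"
      unfolding Ysym by (intro tendsto_intros app)
  qed
  \<comment> \<open>The recursion passes commutation with \<open>A\<close> on to the limit. The
    construction is real linear, and \<open>gramian_difference_sqrt\<close> uses this clause to
    recover complex homogeneity.\<close>
  have comm: "blinfun_apply Yi (J x) = J (blinfun_apply Yi x)"
    if J: "bounded_linear J" and AJ: "\<forall>x. A (J x) = J (A x)" for J x
  proof (rule LIMSEQ_unique)
    have Jl: "linear J" using J by (rule bounded_linear.linear)
    have "blinfun_apply (Y n) (J x) = J (blinfun_apply (Y n) x)" for n x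
      by (induction n arbitrary: x)
        (auto simp: Y0 YS X blinfun.add_left blinfun.scaleR_left AJ linear_0[OF Jl]
          linear_add[OF Jl] linear_diff[OF Jl] linear_scale[OF Jl])
    then show "(\<lambda>n. J (blinfun_apply (Y n) x)) \<longlonglongrightarrow> blinfun_apply Yi (J x)"
      using app[of "J x"] by simp
    show "(\<lambda>n. J (blinfun_apply (Y n) x)) \<longlonglongrightarrow> J (blinfun_apply Yi x)"
      by (rule bounded_linear.tendsto[OF J app])
  qed
  define R where "R x = sqrt K *\<^sub>R (x - blinfun_apply Yi x)" for x
  have Rlin: "bounded_linear R"
    unfolding R_def by (intro bounded_linear_scaleR_right[THEN bounded_linear_compose]
        bounded_linear_sub bounded_linear_ident blinfun.bounded_linear_right)
  have "R (R x) = A x" for x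
  proof -
    \<comment> \<open>The fixed point equation. Substituting it turns the square of 1 - Yi into 1 -
      X, which is A / K.\<close>
    have e: "2 *\<^sub>R blinfun_apply Yi x = blinfun_apply X x + blinfun_apply Yi (blinfun_apply Yi x)"
      by (subst fixp) (simp add: blinfun.add_left blinfun.scaleR_left)
    have "R (R x) = K *\<^sub>R (x - 2 *\<^sub>R blinfun_apply Yi x + blinfun_apply Yi (blinfun_apply Yi x))"
      using K unfolding R_def blinfun.scaleR_right blinfun.diff_right
      by (simp add: algebra_simps scaleR_2)
    also have "\<dots> = A x"
      unfolding e X using K by (simp add: algebra_simps)
    finally show ?thesis .
  qed
  moreover have "inner (R x) z = inner x (R z)" for x z
    by (simp add: R_def inner_diff_left inner_diff_right Yisym)
  moreover have "R (J x) = J (R x)"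
    if "bounded_linear J" "\<forall>x. A (J x) = J (A x)" for J x
    using that comm[OF that]
    by (simp add: R_def linear_diff bounded_linear.linear linear_scale)
  ultimately show ?thesis using Rlin by blast
qed

section \<open>Orthogonal sums of two complex Hilbert spaces\<close>

instantiation prod :: (complex_hilbert, complex_hilbert) complex_hilbert
begin

definition scaleC_prod :: "complex \<Rightarrow> 'a \<times> 'b \<Rightarrow> 'a \<times> 'b"
  where "scaleC_prod c x = (c *\<^sub>C fst x, c *\<^sub>C snd x)"
definition cinner_prod :: "'a \<times> 'b \<Rightarrow> 'a \<times> 'b \<Rightarrow> complex"
  where "cinner_prod x y = cinner (fst x) (fst y) + cinner (snd x) (snd y)"

instance
proof
  fix x y z :: "'a \<times> 'b" and a b :: complex and r :: real
  show "a *\<^sub>C (x + y) = a *\<^sub>C x + a *\<^sub>C y" "(a + b) *\<^sub>C x = a *\<^sub>C x + b *\<^sub>C x"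
      "a *\<^sub>C b *\<^sub>C x = (a * b) *\<^sub>C x" "r *\<^sub>R x = complex_of_real r *\<^sub>C x"
    by (auto simp: scaleC_prod_def scaleC_add_right scaleC_add_left scaleC_scaleC scaleR_prod_def
        scaleR_scaleC)
  show "cinner x y = cnj (cinner y x)"
    unfolding cinner_prod_def complex_cnj_add by (intro arg_cong2[where f=plus] cinner_commute)
  show "cinner (x + y) z = cinner x z + cinner y z"
    by (simp add: cinner_prod_def cinner_add_left)
  show "cinner (a *\<^sub>C x) y = a * cinner x y"
    by (simp add: cinner_prod_def scaleC_prod_def cinner_scaleC_left distrib_left)
  show "inner x y = Re (cinner x y)"
    by (simp add: cinner_prod_def inner_prod_def inner_eq_Re_cinner)
qed

end

section \<open>Direct sums and words\<close>

lemma hnth_hsingle: "hsingle i x $$ j = (if j = i then x else 0)"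
  unfolding hsingle_def
  by (rule Abs_hsum_nth, rule finite_nonzero_values_imp_summable_on)
    (rule finite_subset[of _ "{i}"], auto)

lemma hnth_sum: "(\<Sum>i\<in>I. f i) $$ j = (\<Sum>i\<in>I. (f i :: ('i, 'e::complex_hilbert) hsum) $$ j)"
  by (induction I rule: infinite_finite_induct) auto

lemma bounded_clinear_hnth: "bounded_clinear (\<lambda>x::('i, 'e::complex_hilbert) hsum. x $$ i)"
  by (rule bounded_clinearI[where K=1]) (auto intro: norm_hnth_le)

lemma cinner_hsingle: "cinner (hsingle i x) y = cinner x (y $$ i)"
proof -
  have "cinner (hsingle i x) y = (\<Sum>\<^sub>\<infinity>j\<in>{i}. cinner (hsingle i x $$ j) (y $$ j))"
    unfolding cinner_hsum_def
    by (rule infsum_cong_neutral) (auto simp: hnth_hsingle)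
  then show ?thesis by (simp add: hnth_hsingle)
qed

lemma cinner_hsingle': "cinner y (hsingle i x) = cinner (y $$ i) x"
  unfolding cinner_commute[of y] cinner_hsingle by (rule cinner_commute[symmetric])

lemma inner_hsingle: "inner (hsingle i x) y = inner x (y $$ i)"
  by (simp add: inner_eq_Re_cinner cinner_hsingle)

lemma norm_hsingle: "norm (hsingle i x) = norm x"
  by (simp add: norm_eq_sqrt_inner inner_hsingle hnth_hsingle)

lemma bounded_clinear_hsingle: "bounded_clinear (hsingle i)"
  by (rule bounded_clinearI[where K=1]) (auto simp: norm_hsingle hnth_hsingle intro!: hsum_eqI)

text \<open>By Pythagoras, the squared distance from \<open>y\<close> to a finite partial sum is the
  part of the series of squared norms that has been left out.\<close>

lemma has_sum_hsingle:
  "((\<lambda>i. hsingle i (y $$ i)) has_sum (y :: ('i, 'e::complex_hilbert) hsum)) UNIV"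
proof -
  define s where "s F = (\<Sum>i\<in>F. hsingle i (y $$ i))" for F
  have dist: "(norm (s F - y))\<^sup>2 = (norm y)\<^sup>2 - (\<Sum>i\<in>F. (norm (y $$ i))\<^sup>2)" if "finite F" for F
  proof -
    have a: "inner (s F) z = (\<Sum>i\<in>F. inner (y $$ i) (z $$ i))" for z
      by (simp add: s_def inner_sum_left inner_hsingle)
    have "s F $$ i = y $$ i" if "i \<in> F" for i
      using that \<open>finite F\<close> by (simp add: s_def hnth_sum hnth_hsingle)
    then have "inner (s F) (s F) = (\<Sum>i\<in>F. (norm (y $$ i))\<^sup>2)"
      by (simp add: a power2_norm_eq_inner)
    moreover have "inner (s F) y = (\<Sum>i\<in>F. (norm (y $$ i))\<^sup>2)"
      by (simp add: a power2_norm_eq_inner)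
    ultimately show ?thesis
      unfolding power2_norm_eq_inner[of "s F - y"] power2_norm_eq_inner[of y]
        inner_diff_left inner_diff_right inner_commute[of y "s F"] by simp
  qed
  have "((\<lambda>i. (norm (y $$ i))\<^sup>2) has_sum (norm y)\<^sup>2) UNIV"
    unfolding norm2_hsum by (rule has_sum_infsum) (rule hnth_summable)
  then have "((\<lambda>F. (norm y)\<^sup>2 - (\<Sum>i\<in>F. (norm (y $$ i))\<^sup>2)) \<longlongrightarrow> (norm y)\<^sup>2 - (norm y)\<^sup>2)
      (finite_subsets_at_top UNIV)"
    unfolding has_sum_def by (intro tendsto_intros)
  then have "((\<lambda>F. (norm y)\<^sup>2 - (\<Sum>i\<in>F. (norm (y $$ i))\<^sup>2)) \<longlongrightarrow> 0) (finite_subsets_at_top UNIV)"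
    by simp
  then have "((\<lambda>F. (norm (s F - y))\<^sup>2) \<longlongrightarrow> 0) (finite_subsets_at_top UNIV)"
    by (rule Lim_transform_eventually)
      (rule eventually_finite_subsets_at_top_weakI, simp add: dist)
  then have "((\<lambda>F. sqrt ((norm (s F - y))\<^sup>2)) \<longlongrightarrow> sqrt 0) (finite_subsets_at_top UNIV)"
    by (rule tendsto_real_sqrt)
  then have "((\<lambda>F. s F - y) \<longlongrightarrow> 0) (finite_subsets_at_top UNIV)"
    by (simp add: tendsto_norm_zero_iff)
  then have "(s \<longlongrightarrow> y) (finite_subsets_at_top UNIV)"
    by (rule Lim_null[THEN iffD2])
  then show ?thesis by (simp add: has_sum_def s_def[abs_def])
qed

lemma bounded_clinear_eq_on_hsingle:
  fixes A B :: "('i, 'e::complex_hilbert) hsum \<Rightarrow> 'g::complex_hilbert"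
  assumes A: "bounded_clinear A" and B: "bounded_clinear B"
    and eq: "\<And>i x. A (hsingle i x) = B (hsingle i x)"
  shows "A y = B y"
proof -
  have "((\<lambda>i. A (hsingle i (y $$ i))) has_sum A y) UNIV"
    using has_sum_bounded_linear[OF bounded_clinear_linear[OF A] has_sum_hsingle[of y]]
    by (simp add: o_def)
  moreover have "((\<lambda>i. A (hsingle i (y $$ i))) has_sum B y) UNIV"
    using has_sum_bounded_linear[OF bounded_clinear_linear[OF B] has_sum_hsingle[of y]]
    by (simp add: o_def eq)
  ultimately show ?thesis by (rule has_sum_unique)
qed

text \<open>\<open>row_op\<close> is an infinite sum, which is 0 by convention where it diverges.
  Recognising it as the adjoint of a bounded column \<open>J\<close> supplies convergence,
  boundedness and, in \<open>cadjoint_row_op\<close>, the adjoint.\<close>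

lemma row_op_eq_cadjoint:
  fixes J :: "'g::complex_hilbert \<Rightarrow> ('i, 'e::complex_hilbert) hsum"
  assumes J: "bounded_clinear J" and R: "\<And>i x y. cinner (R i x) y = cinner x (J y $$ i)"
  shows "row_op R = J\<dagger>"
proof
  fix y
  have "R i x = J\<dagger> (hsingle i x)" for i x
  proof (rule eq_if_inner_eq)
    fix z
    show "inner (R i x) z = inner (J\<dagger> (hsingle i x)) z"
      unfolding inner_eq_Re_cinner cinner_cadjoint'[OF J] cinner_hsingle R ..
  qed
  then have "((\<lambda>i. R i (y $$ i)) has_sum J\<dagger> y) UNIV"
    using has_sum_bounded_linear[OF bounded_clinear_linear[OF bounded_clinear_cadjoint[OF J]]
        has_sum_hsingle[of y]]
    by (simp add: o_def)
  then show "row_op R y = J\<dagger> y" unfolding row_op_def by (rule infsumI)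
qed

lemma cadjoint_row_op:
  fixes J :: "'g::complex_hilbert \<Rightarrow> ('i, 'e::complex_hilbert) hsum"
  assumes "bounded_clinear J" and "\<And>i x y. cinner (R i x) y = cinner x (J y $$ i)"
  shows "(row_op R)\<dagger> = J"
  unfolding row_op_eq_cadjoint[OF assms] by (rule cadjoint_cadjoint[OF assms(1)])

section \<open>Sums over words and backward shifts\<close>

lemma finite_words: "finite {\<sigma> :: 'n::finite list. length \<sigma> = n}"
  using finite_lists_length_eq[of "UNIV :: 'n set" n] by simp

lemma sum_words_Suc:
  fixes f :: "'n::finite list \<Rightarrow> 'b::comm_monoid_add"
  shows "(\<Sum>\<sigma> | length \<sigma> = Suc n. f \<sigma>) = (\<Sum>a\<in>UNIV. \<Sum>\<sigma> | length \<sigma> = n. f (a # \<sigma>))"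
proof -
  have "(\<Sum>a\<in>UNIV. \<Sum>\<sigma> | length \<sigma> = n. f (a # \<sigma>))
      = (\<Sum>(a, \<sigma>)\<in>UNIV \<times> {\<sigma>. length \<sigma> = n}. f (a # \<sigma>))"
    by (rule sum.cartesian_product)
  also have "\<dots> = (\<Sum>\<sigma> | length \<sigma> = Suc n. f \<sigma>)"
    by (rule sum.reindex_bij_witness[where i="\<lambda>\<sigma>. (hd \<sigma>, tl \<sigma>)" and j="\<lambda>(a, \<sigma>). a # \<sigma>"])
      (auto simp: length_Suc_conv)
  finally show ?thesis by simp
qed

text \<open>Inductions that run \<open>fold G\<close> along words split off the last letter, because
  \<open>fold G (\<sigma> @ [a]) x = G a (fold G \<sigma> x)\<close>.\<close>

lemma sum_words_Suc':
  fixes f :: "'n::finite list \<Rightarrow> 'b::comm_monoid_add"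
  shows "(\<Sum>\<sigma> | length \<sigma> = Suc n. f \<sigma>) = (\<Sum>\<sigma> | length \<sigma> = n. \<Sum>a\<in>UNIV. f (\<sigma> @ [a]))"
proof (induction n arbitrary: f)
  case 0
  show ?case by (simp add: sum_words_Suc)
next
  case (Suc n)
  have "(\<Sum>\<sigma> | length \<sigma> = Suc (Suc n). f \<sigma>)
      = (\<Sum>b\<in>UNIV. \<Sum>\<sigma> | length \<sigma> = n. \<Sum>a\<in>UNIV. f (b # \<sigma> @ [a]))"
    unfolding sum_words_Suc[of _ "Suc n"] by (intro sum.cong refl Suc)
  also have "\<dots> = (\<Sum>\<sigma> | length \<sigma> = Suc n. \<Sum>a\<in>UNIV. f (\<sigma> @ [a]))"
    by (simp add: sum_words_Suc)
  finally show ?case .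
qed

text \<open>Apart from the empty word, there is one copy of the set of all words for each first
  letter. This is what splits the Fock space into its root component and \<open>CARD('n)\<close>
  copies of itself.\<close>

lemma infsum_words:
  fixes f :: "'n::finite list \<Rightarrow> 'b::banach"
  assumes f: "f summable_on UNIV"
  shows "infsum f UNIV = f [] + (\<Sum>a\<in>UNIV. \<Sum>\<^sub>\<infinity>\<sigma>. f (a # \<sigma>))"
proof -
  let ?c = "\<lambda>(a, \<sigma>). a # \<sigma> :: 'n list"
  have U: "UNIV = insert [] (range ?c)"
    by (auto simp: image_iff) (metis list.exhaust)
  have inj: "inj ?c" by (auto intro!: injI)
  have s: "f summable_on range ?c" using f by (rule summable_on_subset_banach) simp
  then have s2: "(f \<circ> ?c) summable_on UNIV \<times> UNIV"
    using inj by (subst summable_on_reindex[symmetric]) (auto simp: UNIV_Times_UNIV)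
  have "infsum f UNIV = f [] + infsum f (range ?c)"
    by (subst U, rule infsum_insert) (use s in auto)
  also have "infsum f (range ?c) = infsum (f \<circ> ?c) (UNIV \<times> UNIV)"
    using inj by (subst infsum_reindex) (auto simp: UNIV_Times_UNIV)
  also have "\<dots> = (\<Sum>\<^sub>\<infinity>a\<in>UNIV. \<Sum>\<^sub>\<infinity>\<sigma>\<in>UNIV. (f \<circ> ?c) (a, \<sigma>))"
    by (rule infsum_Sigma_banach[symmetric]) (rule s2)
  also have "\<dots> = (\<Sum>a\<in>UNIV. \<Sum>\<^sub>\<infinity>\<sigma>. f (a # \<sigma>))"
    by (simp add: o_def)
  finally show ?thesis .
qed

text \<open>The adjoint of the creation operator that prefixes the letter \<open>a\<close> to every
  word.\<close>

definition bshift :: "'n \<Rightarrow> ('n, 'e::complex_hilbert) fock \<Rightarrow> ('n, 'e) fock" where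
  "bshift a y = Abs_hsum (\<lambda>\<sigma>. y $$ (a # \<sigma>))"

lemma hnth_bshift: "bshift a y $$ \<sigma> = y $$ (a # \<sigma>)"
proof -
  have "(\<lambda>\<sigma>. (norm (y $$ \<sigma>))\<^sup>2) summable_on range (Cons a)"
    using hnth_summable by (rule summable_on_subset_banach) simp
  then have "((\<lambda>\<sigma>. (norm (y $$ \<sigma>))\<^sup>2) \<circ> Cons a) summable_on UNIV"
    by (subst summable_on_reindex[symmetric]) auto
  then show ?thesis
    unfolding bshift_def by (intro Abs_hsum_nth) (simp add: o_def)
qed

lemma cinner_fock:
  fixes y z :: "('n::finite, 'e::complex_hilbert) fock"
  shows "cinner y z = cinner (y $$ []) (z $$ []) + (\<Sum>a\<in>UNIV. cinner (bshift a y) (bshift a z))"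
  unfolding cinner_hsum_def hnth_bshift by (rule infsum_words) (rule summable_cinner)

lemma norm2_fock:
  fixes y :: "('n::finite, 'e::complex_hilbert) fock"
  shows "(norm y)\<^sup>2 = (norm (y $$ []))\<^sup>2 + (\<Sum>a\<in>UNIV. (norm (bshift a y))\<^sup>2)"
  by (simp add: power2_norm_eq_inner inner_eq_Re_cinner cinner_fock[of y])

lemma bounded_clinear_bshift:
  "bounded_clinear (bshift a :: ('n::finite, 'e::complex_hilbert) fock \<Rightarrow> _)"
proof (rule bounded_clinearI[where K=1])
  fix y :: "('n, 'e) fock"
  have "(norm (bshift a y))\<^sup>2 \<le> (\<Sum>a\<in>UNIV. (norm (bshift a y))\<^sup>2)"
    by (rule member_le_sum) auto
  also have "\<dots> \<le> (norm y)\<^sup>2" unfolding norm2_fock[of y] by simp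
  finally show "norm (bshift a y) \<le> 1 * norm y" using power2_le_imp_le[OF _ norm_ge_zero] by auto
qed (auto intro!: hsum_eqI simp: hnth_bshift)

lemma bshift_hsingle_Nil: "bshift a (hsingle [] x) = 0"
  by (rule hsum_eqI) (simp add: hnth_bshift hnth_hsingle)

lemma bshift_hsingle_Cons: "bshift a (hsingle (b # \<sigma>) x) = (if a = b then hsingle \<sigma> x else 0)"
  by (rule hsum_eqI) (simp add: hnth_bshift hnth_hsingle)

lemma hnth_fold_bshift: "fold bshift \<sigma> y $$ \<tau> = y $$ (\<sigma> @ \<tau>)"
  by (induction \<sigma> arbitrary: y) (auto simp: hnth_bshift)

lemma fold_commute_apply: "(\<And>a x. T (f a x) = g a (T x)) \<Longrightarrow> T (fold f \<sigma> x) = fold g \<sigma> (T x)"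
  by (induction \<sigma> arbitrary: x) auto

text \<open>Any finite set of words lies among the words of length below some \<open>m\<close>, so
  bounds on the level sums control all finite partial sums.\<close>

lemma summable_words:
  fixes f :: "'n::finite list \<Rightarrow> real"
  assumes f: "\<And>\<sigma>. 0 \<le> f \<sigma>" and le: "\<And>m. (\<Sum>n<m. \<Sum>\<sigma> | length \<sigma> = n. f \<sigma>) \<le> C"
  shows "f summable_on UNIV" and "infsum f UNIV \<le> C"
proof -
  have fin: "sum f F \<le> C" if "finite F" for F
  proof -
    obtain m where m: "\<And>\<sigma>. \<sigma> \<in> F \<Longrightarrow> length \<sigma> < m"
    proof
      show "length \<sigma> < Suc (Max (length ` F))" if "\<sigma> \<in> F" for \<sigma>
        using that \<open>finite F\<close> by (simp add: less_Suc_eq_le)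
    qed
    have "sum f F \<le> sum f (\<Union>n<m. {\<sigma>. length \<sigma> = n})"
      by (rule sum_mono2) (use f m finite_words in auto)
    also have "\<dots> = (\<Sum>n<m. \<Sum>\<sigma> | length \<sigma> = n. f \<sigma>)"
      by (rule sum.UNION_disjoint) (auto simp: finite_words)
    finally show ?thesis using le[of m] by linarith
  qed
  show s: "f summable_on UNIV"
    by (rule nonneg_bdd_above_summable_on) (use f fin in \<open>auto intro!: bdd_aboveI\<close>)
  show "infsum f UNIV \<le> C"
    by (rule infsum_le_finite_sums[OF s]) (rule fin)
qed

section \<open>Observability operators\<close>

text \<open>The observability operator of the pair \<open>(G, u)\<close>. If \<open>G\<close>
  consists of the adjoints of a tuple \<open>F\<close>, then \<open>fold G \<sigma>\<close> is the
  adjoint of \<open>word_op F \<sigma>\<close>: the first letter acts first.\<close>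

definition column ::
    "('n \<Rightarrow> 'x \<Rightarrow> 'x) \<Rightarrow> ('x \<Rightarrow> 'e) \<Rightarrow> 'x \<Rightarrow> ('n, 'e::complex_hilbert) fock" where
  "column G u x = Abs_hsum (\<lambda>\<sigma>. u (fold G \<sigma> x))"

lemma bounded_clinear_fold:
  "(\<And>a. bounded_clinear (G a)) \<Longrightarrow> bounded_clinear (fold G \<sigma>)"
proof (induction \<sigma>)
  case (Cons a \<sigma>)
  then show ?case using bounded_clinear_compose[of "fold G \<sigma>" "G a"] by (simp add: o_def)
qed (simp add: id_def bounded_clinear_id)

text \<open>The energy bound makes the coefficients square summable; only then does
  \<open>Abs_hsum\<close> return the intended vector.\<close>

lemma
  fixes G :: "'n::finite \<Rightarrow> 'x::complex_hilbert \<Rightarrow> 'x" and u :: "'x \<Rightarrow> 'e::complex_hilbert"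
  assumes G: "\<And>a. bounded_clinear (G a)" and u: "bounded_clinear u" and C: "0 \<le> C"
    and bound: "\<And>m x. (\<Sum>n<m. \<Sum>\<sigma> | length \<sigma> = n. (norm (u (fold G \<sigma> x)))\<^sup>2) \<le> C\<^sup>2 * (norm x)\<^sup>2"
  shows hnth_column: "column G u x $$ \<sigma> = u (fold G \<sigma> x)"
    and norm_column: "norm (column G u x) \<le> C * norm x"
    and bounded_clinear_column: "bounded_clinear (column G u)"
proof -
  note words = summable_words[of "\<lambda>\<sigma>. (norm (u (fold G \<sigma> x)))\<^sup>2" "C\<^sup>2 * (norm x)\<^sup>2" for x,
      OF zero_le_power2 bound]
  have nth: "column G u x $$ \<sigma> = u (fold G \<sigma> x)" for x \<sigma>
    unfolding column_def by (rule Abs_hsum_nth) (rule words(1))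
  have nrm: "norm (column G u x) \<le> C * norm x" for x
  proof (rule power2_le_imp_le)
    show "(norm (column G u x))\<^sup>2 \<le> (C * norm x)\<^sup>2"
      unfolding norm2_hsum nth power_mult_distrib by (rule words(2))
  qed (use C in simp)
  have cl: "bounded_clinear (\<lambda>x. u (fold G \<sigma> x))" for \<sigma>
    by (rule bounded_clinear_compose[OF u bounded_clinear_fold[OF G]])
  show "column G u x $$ \<sigma> = u (fold G \<sigma> x)" by (rule nth)
  show "norm (column G u x) \<le> C * norm x" by (rule nrm)
  show "bounded_clinear (column G u)"
  proof (rule bounded_clinearI[OF _ _ nrm])
    fix x y c
    show "column G u (x + y) = column G u x + column G u y"
      by (rule hsum_eqI) (simp only: nth hnth_plus bounded_clinear_add[OF cl])
    show "column G u (c *\<^sub>C x) = c *\<^sub>C column G u x"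
      by (rule hsum_eqI) (simp only: nth hnth_scaleC bounded_clinear_scaleC[OF cl])
  qed
qed

text \<open>Geometric decay is asked for only up to a constant \<open>C\<close>, since the tuples at
  hand need not be jointly contractive: their off-diagonal identity blocks can increase norms before
  the decay sets in.\<close>

definition stable :: "('n::finite \<Rightarrow> 'x \<Rightarrow> 'x::complex_hilbert) \<Rightarrow> bool" where
  "stable G \<longleftrightarrow> (\<forall>a. bounded_clinear (G a)) \<and> (\<exists>C q. 0 \<le> C \<and> 0 \<le> q \<and> q < 1 \<and>
    (\<forall>n x. (\<Sum>\<sigma> | length \<sigma> = n. (norm (fold G \<sigma> x))\<^sup>2) \<le> C * q ^ n * (norm x)\<^sup>2))"

lemma stable_bounded_clinear: "stable G \<Longrightarrow> bounded_clinear (G a)"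
  unfolding stable_def by (elim conjE) (rule spec)

lemma stable_tendsto:
  assumes "stable G"
  shows "(\<lambda>n. \<Sum>\<sigma> | length \<sigma> = n. (norm (fold G \<sigma> x))\<^sup>2) \<longlonglongrightarrow> 0"
proof -
  obtain C q where q: "0 \<le> q" "q < 1"
    and le: "\<And>n x. (\<Sum>\<sigma> | length \<sigma> = n. (norm (fold G \<sigma> x))\<^sup>2) \<le> C * q ^ n * (norm x)\<^sup>2"
    using assms by (auto simp: stable_def)
  show ?thesis
  proof (rule tendsto_sandwich[where f="\<lambda>_. 0"])
    have "(\<lambda>n. C * q ^ n * (norm x)\<^sup>2) \<longlonglongrightarrow> C * 0 * (norm x)\<^sup>2"
      by (intro tendsto_intros LIMSEQ_power_zero) (use q in simp)
    then show "(\<lambda>n. C * q ^ n * (norm x)\<^sup>2) \<longlonglongrightarrow> 0" by simp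
  qed (auto intro!: always_eventually sum_nonneg le)
qed

lemma stable_bound:
  assumes "stable G" and u: "bounded_clinear u"
  shows "\<exists>C\<ge>0. \<forall>m x. (\<Sum>n<m. \<Sum>\<sigma> | length \<sigma> = n. (norm (u (fold G \<sigma> x)))\<^sup>2) \<le> C\<^sup>2 * (norm x)\<^sup>2"
proof -
  obtain C q where C: "0 \<le> C" and q: "0 \<le> q" "q < 1"
    and le: "\<And>n x. (\<Sum>\<sigma> | length \<sigma> = n. (norm (fold G \<sigma> x))\<^sup>2) \<le> C * q ^ n * (norm x)\<^sup>2"
    using assms by (auto simp: stable_def)
  obtain K where K: "K > 0" "\<And>x. norm (u x) \<le> K * norm x"
    using bounded_clinear_bound[OF u] by blast
  define D where "D = sqrt (K\<^sup>2 * C / (1 - q))"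
  have D2: "D\<^sup>2 = K\<^sup>2 * C / (1 - q)" using C q by (simp add: D_def)
  have "(\<Sum>n<m. \<Sum>\<sigma> | length \<sigma> = n. (norm (u (fold G \<sigma> x)))\<^sup>2) \<le> D\<^sup>2 * (norm x)\<^sup>2" for m x
  proof -
    have "(\<Sum>\<sigma> | length \<sigma> = n. (norm (u (fold G \<sigma> x)))\<^sup>2) \<le> K\<^sup>2 * C * (norm x)\<^sup>2 * q ^ n" for n
    proof -
      have "(norm (u (fold G \<sigma> x)))\<^sup>2 \<le> K\<^sup>2 * (norm (fold G \<sigma> x))\<^sup>2" for \<sigma>
        unfolding power_mult_distrib[symmetric] by (intro power_mono K) simp
      then have "(\<Sum>\<sigma> | length \<sigma> = n. (norm (u (fold G \<sigma> x)))\<^sup>2)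
          \<le> K\<^sup>2 * (\<Sum>\<sigma> | length \<sigma> = n. (norm (fold G \<sigma> x))\<^sup>2)"
        unfolding sum_distrib_left by (intro sum_mono)
      also have "\<dots> \<le> K\<^sup>2 * (C * q ^ n * (norm x)\<^sup>2)"
        by (intro mult_left_mono le) simp
      finally show ?thesis by (simp add: mult_ac)
    qed
    then have "(\<Sum>n<m. \<Sum>\<sigma> | length \<sigma> = n. (norm (u (fold G \<sigma> x)))\<^sup>2)
        \<le> K\<^sup>2 * C * (norm x)\<^sup>2 * (\<Sum>n<m. q ^ n)"
      unfolding sum_distrib_left by (intro sum_mono)
    also have "\<dots> \<le> K\<^sup>2 * C * (norm x)\<^sup>2 * (1 / (1 - q))"
      using q C sum_le_suminf[of "\<lambda>n. q ^ n" "{..<m}"] suminf_geometric[of q]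
      by (intro mult_left_mono) (simp_all add: summable_geometric)
    finally show ?thesis unfolding D2 by simp
  qed
  moreover have "D \<ge> 0" using C q by (simp add: D_def)
  ultimately show ?thesis by blast
qed

lemma
  assumes "stable G" and u: "bounded_clinear u"
  shows hnth_column_stable: "column G u x $$ \<sigma> = u (fold G \<sigma> x)"
    and bounded_clinear_column_stable: "bounded_clinear (column G u)"
proof -
  obtain C where C: "0 \<le> C" "\<And>m x. (\<Sum>n<m. \<Sum>\<sigma> | length \<sigma> = n. (norm (u (fold G \<sigma> x)))\<^sup>2) \<le> C\<^sup>2 * (norm x)\<^sup>2"
    using stable_bound[OF assms] by blast
  show "column G u x $$ \<sigma> = u (fold G \<sigma> x)" "bounded_clinear (column G u)"
    using hnth_column[OF stable_bounded_clinear[OF assms(1)] u C]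
      bounded_clinear_column[OF stable_bounded_clinear[OF assms(1)] u C] by blast+
qed

lemma bshift_column:
  assumes "stable G" and "bounded_clinear u"
  shows "bshift a (column G u x) = column G u (G a x)"
  by (rule hsum_eqI) (simp add: hnth_bshift hnth_column_stable[OF assms])

text \<open>Triangularity and the ampliation rule together say that the entry at
  \<open>(a # \<sigma>, b # \<tau>)\<close> is the entry at \<open>(\<sigma>, \<tau>)\<close> if
  \<open>a = b\<close> and 0 otherwise, and that the entry at \<open>(a # \<sigma>, [])\<close> is
  0. Tested on the vectors \<open>hsingle \<tau> x\<close>, this is commutation with the backward
  shifts.\<close>

lemma UT_iff:
  fixes T :: "('n::finite, 'e::complex_hilbert) fock \<Rightarrow> ('n, 'e) fock"
  shows "T \<in> UT \<longleftrightarrow> bounded_clinear T \<and> (\<forall>a y. bshift a (T y) = T (bshift a y))"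
proof (intro iffI conjI allI)
  assume T: "T \<in> UT"
  then show cl: "bounded_clinear T" by (simp add: UT_def)
  note zero = bounded_clinear_zero[OF cl]
  have low: "entry T \<sigma> \<tau> x = 0" if "length \<tau> < length \<sigma>" for \<sigma> \<tau> x
    using T that by (simp add: UT_def)
  have amp: "entry T \<sigma> \<tau> x = ampliation (entry T) \<sigma> \<tau> x"
    if "1 \<le> length \<sigma>" "length \<sigma> \<le> length \<tau>" for \<sigma> \<tau> x
    using T that by (simp add: UT_def)
  \<comment> \<open>Below the diagonal, where the ampliation rule is silent, both sides are 0 by
    \<open>low\<close>.\<close>
  have step: "entry T (a # \<sigma>) (b # \<tau>) x = (if a = b then entry T \<sigma> \<tau> x else 0)" for a \<sigma> b \<tau> x
    using low[of "b # \<tau>" "a # \<sigma>" x] low[of \<tau> \<sigma> x] amp[of "a # \<sigma>" "b # \<tau>" x]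
    by (cases "length \<sigma> \<le> length \<tau>") auto
  fix a y
  show "bshift a (T y) = T (bshift a y)"
  proof (rule bounded_clinear_eq_on_hsingle[of "\<lambda>y. bshift a (T y)" "\<lambda>y. T (bshift a y)"])
    show "bounded_clinear (\<lambda>y. bshift a (T y))"
      by (rule bounded_clinear_compose[OF bounded_clinear_bshift cl])
    show "bounded_clinear (\<lambda>y. T (bshift a y))"
      by (rule bounded_clinear_compose[OF cl bounded_clinear_bshift])
    fix \<tau> x
    show "bshift a (T (hsingle \<tau> x)) = T (bshift a (hsingle \<tau> x))"
    proof (rule hsum_eqI)
      fix \<sigma>
      show "bshift a (T (hsingle \<tau> x)) $$ \<sigma> = T (bshift a (hsingle \<tau> x)) $$ \<sigma>"
        using low[of "[]" "a # \<sigma>" x] step[of a \<sigma> _ _ x]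
        by (cases \<tau>) (auto simp: bshift_hsingle_Nil bshift_hsingle_Cons hnth_bshift entry_def zero)
    qed
  qed
next
  assume T: "bounded_clinear T \<and> (\<forall>a y. bshift a (T y) = T (bshift a y))"
  then have cl: "bounded_clinear T" and comm: "\<And>a y. T (bshift a y) = bshift a (T y)" by auto
  note zero = bounded_clinear_zero[OF cl]
  have Nil: "entry T (a # \<sigma>) [] x = 0" for a \<sigma> x
    using comm[of a "hsingle [] x"]
    by (simp add: bshift_hsingle_Nil zero entry_def flip: hnth_bshift)
  have step: "entry T (a # \<sigma>) (b # \<tau>) x = (if a = b then entry T \<sigma> \<tau> x else 0)" for a \<sigma> b \<tau> x
    using comm[of a "hsingle (b # \<tau>) x"]
    by (auto simp: bshift_hsingle_Cons zero entry_def simp flip: hnth_bshift)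
  \<comment> \<open>Stripping first letters in pairs ends in a mismatch of letters or exhausts the
    shorter word \<open>\<tau>\<close>, where \<open>Nil\<close> applies.\<close>
  have low: "entry T \<sigma> \<tau> x = 0" if "length \<tau> < length \<sigma>" for \<sigma> \<tau> x
    using that
  proof (induction \<sigma> arbitrary: \<tau>)
    case (Cons a \<sigma>)
    then show ?case by (cases \<tau>) (auto simp: Nil step)
  qed simp
  have "entry T \<sigma> \<tau> x = ampliation (entry T) \<sigma> \<tau> x" if "1 \<le> length \<sigma>" "length \<sigma> \<le> length \<tau>" for \<sigma> \<tau> x
    using that by (cases \<sigma>; cases \<tau>) (auto simp: step)
  then show "T \<in> UT"
    using cl low by (auto simp: UT_def)
qed

section \<open>The lurking isometry\<close>

lemma hnth_Abs_finite: "Abs_hsum f $$ (i :: 'i::finite) = f i"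
  by (rule Abs_hsum_nth) simp

lemma norm2_Abs_finite: "(norm (Abs_hsum f :: ('i::finite, 'e::complex_hilbert) hsum))\<^sup>2 = (\<Sum>i\<in>UNIV. (norm (f i))\<^sup>2)"
  by (simp add: norm2_hsum hnth_Abs_finite)

lemma cinner_Abs_finite:
  "cinner (Abs_hsum f :: ('i::finite, 'e::complex_hilbert) hsum) z = (\<Sum>i\<in>UNIV. cinner (f i) (z $$ i))"
  by (simp add: cinner_hsum_def hnth_Abs_finite)

lemma norm2_prod: "(norm (x :: 'a::real_normed_vector \<times> 'b::real_normed_vector))\<^sup>2 = (norm (fst x))\<^sup>2 + (norm (snd x))\<^sup>2"
  by (simp add: norm_prod_def)

lemma bounded_clinear_fst: "bounded_clinear (fst :: 'a::complex_hilbert \<times> 'b::complex_hilbert \<Rightarrow> 'a)"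
  by (simp add: bounded_clinear_def bounded_linear_fst scaleC_prod_def)

lemma bounded_clinear_snd: "bounded_clinear (snd :: 'a::complex_hilbert \<times> 'b::complex_hilbert \<Rightarrow> 'b)"
  by (simp add: bounded_clinear_def bounded_linear_snd scaleC_prod_def)

lemma bounded_clinear_Pair_left: "bounded_clinear (\<lambda>x::'a::complex_hilbert. (x, 0::'b::complex_hilbert))"
  by (rule bounded_clinearI[where K=1]) (auto simp: scaleC_prod_def norm_Pair)

lemma bounded_clinear_inputs:
  fixes f :: "'i::finite \<Rightarrow> 'x::complex_hilbert \<Rightarrow> 'k::complex_hilbert" and u :: "'x \<Rightarrow> 'e::complex_hilbert"
  assumes f: "\<And>i. bounded_clinear (f i)" and u: "bounded_clinear u"
  shows "bounded_clinear (\<lambda>x. (Abs_hsum (\<lambda>i. f i x), u x))"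
proof -
  have "\<exists>K>0. \<forall>x. norm (f i x) \<le> K * norm x" for i
    by (rule bounded_clinear_bound[OF f[of i]]) blast
  then obtain K where K: "\<And>i. K i > 0" "\<And>i x. norm (f i x) \<le> K i * norm x"
    by metis
  obtain L where L: "L > 0" "\<And>x. norm (u x) \<le> L * norm x"
    using bounded_clinear_bound[OF u] by metis
  define M where "M = (\<Sum>i\<in>UNIV. (K i)\<^sup>2) + L\<^sup>2"
  have M: "M \<ge> 0" unfolding M_def by (intro add_nonneg_nonneg sum_nonneg) auto
  show ?thesis
  proof (rule bounded_clinearI[where K="sqrt M"])
    fix x y c
    show "(Abs_hsum (\<lambda>i. f i (x + y)), u (x + y)) = (Abs_hsum (\<lambda>i. f i x), u x) + (Abs_hsum (\<lambda>i. f i y), u y)"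
      by (auto intro!: hsum_eqI simp: hnth_Abs_finite bounded_clinear_add[OF f] bounded_clinear_add[OF u])
    show "(Abs_hsum (\<lambda>i. f i (c *\<^sub>C x)), u (c *\<^sub>C x)) = c *\<^sub>C (Abs_hsum (\<lambda>i. f i x), u x)"
      by (auto intro!: hsum_eqI
          simp: scaleC_prod_def hnth_Abs_finite bounded_clinear_scaleC[OF f] bounded_clinear_scaleC[OF u])
    have "(norm (f i x))\<^sup>2 \<le> (K i)\<^sup>2 * (norm x)\<^sup>2" for i
      unfolding power_mult_distrib[symmetric] by (rule power_mono[OF K(2)]) simp
    moreover have "(norm (u x))\<^sup>2 \<le> L\<^sup>2 * (norm x)\<^sup>2"
      unfolding power_mult_distrib[symmetric] by (rule power_mono[OF L(2)]) simp
    ultimately have "(norm (Abs_hsum (\<lambda>i. f i x), u x))\<^sup>2 \<le> M * (norm x)\<^sup>2"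
      unfolding norm2_prod M_def distrib_right sum_distrib_right fst_conv snd_conv norm2_Abs_finite
      by (intro add_mono sum_mono)
    also have "\<dots> = (sqrt M * norm x)\<^sup>2"
      using M by (simp add: power_mult_distrib)
    finally show "norm (Abs_hsum (\<lambda>i. f i x), u x) \<le> sqrt M * norm x"
      by (rule power2_le_imp_le) (use M in simp)
  qed
qed

text \<open>\<open>\<psi>\<close> is a storage function: a step from \<open>x\<close> emits the
  energy of \<open>u x\<close> and leaves at most the rest to the successors \<open>G a x\<close>.
  Over the levels this telescopes, with the storage at level \<open>m\<close> as remainder.\<close>

lemma sum_words_potential:
  fixes G :: "'n::finite \<Rightarrow> 'x \<Rightarrow> 'x" and \<psi> :: "'x \<Rightarrow> real" and u :: "'x \<Rightarrow> 'e::real_normed_vector"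
  assumes "\<And>x. 0 \<le> \<psi> x" and step: "\<And>x. (norm (u x))\<^sup>2 + (\<Sum>a\<in>UNIV. \<psi> (G a x)) \<le> \<psi> x"
  shows "(\<Sum>n<m. \<Sum>\<sigma> | length \<sigma> = n. (norm (u (fold G \<sigma> x)))\<^sup>2) \<le> \<psi> x"
proof -
  have "(\<Sum>n<m. \<Sum>\<sigma> | length \<sigma> = n. (norm (u (fold G \<sigma> x)))\<^sup>2)
      + (\<Sum>\<sigma> | length \<sigma> = m. \<psi> (fold G \<sigma> x)) \<le> \<psi> x"
  proof (induction m)
    case (Suc m)
    have "(\<Sum>\<sigma> | length \<sigma> = m. (norm (u (fold G \<sigma> x)))\<^sup>2) + (\<Sum>\<sigma> | length \<sigma> = Suc m. \<psi> (fold G \<sigma> x))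
        \<le> (\<Sum>\<sigma> | length \<sigma> = m. \<psi> (fold G \<sigma> x))"
      unfolding sum_words_Suc' sum.distrib[symmetric] by (intro sum_mono) (simp add: step)
    then show ?case using Suc by simp
  qed simp
  moreover have "0 \<le> (\<Sum>\<sigma> | length \<sigma> = m. \<psi> (fold G \<sigma> x))" by (intro sum_nonneg assms)
  ultimately show ?thesis by linarith
qed

text \<open>Iterating \<open>step\<close> bounds \<open>\<Delta> x\<close> by a sum over the words
  of length \<open>n\<close>, which stability sends to 0.\<close>

lemma zero_if_stable_decreasing:
  fixes G :: "'n::finite \<Rightarrow> 'x::complex_hilbert \<Rightarrow> 'x" and \<Delta> :: "'x \<Rightarrow> 'y::complex_hilbert"
  assumes G: "stable G" and \<Delta>: "bounded_clinear \<Delta>"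
    and step: "\<And>x. (norm (\<Delta> x))\<^sup>2 \<le> (\<Sum>a\<in>UNIV. (norm (\<Delta> (G a x)))\<^sup>2)"
  shows "\<Delta> x = 0"
proof -
  obtain K where K: "K > 0" "\<And>x. norm (\<Delta> x) \<le> K * norm x"
    using bounded_clinear_bound[OF \<Delta>] by metis
  have "(norm (\<Delta> x))\<^sup>2 \<le> K\<^sup>2 * (\<Sum>\<sigma> | length \<sigma> = n. (norm (fold G \<sigma> x))\<^sup>2)" for n
  proof -
    have "(norm (\<Delta> x))\<^sup>2 \<le> (\<Sum>\<sigma> | length \<sigma> = n. (norm (\<Delta> (fold G \<sigma> x)))\<^sup>2)"
    proof (induction n)
      case (Suc n)
      have "(\<Sum>\<sigma> | length \<sigma> = n. (norm (\<Delta> (fold G \<sigma> x)))\<^sup>2)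
          \<le> (\<Sum>\<sigma> | length \<sigma> = Suc n. (norm (\<Delta> (fold G \<sigma> x)))\<^sup>2)"
        unfolding sum_words_Suc' by (intro sum_mono) (simp add: step)
      with Suc show ?case by linarith
    qed simp
    also have "\<dots> \<le> (\<Sum>\<sigma> | length \<sigma> = n. K\<^sup>2 * (norm (fold G \<sigma> x))\<^sup>2)"
      unfolding power_mult_distrib[symmetric] by (intro sum_mono power_mono K(2)) simp
    finally show ?thesis by (simp add: sum_distrib_left)
  qed
  moreover have "(\<lambda>n. K\<^sup>2 * (\<Sum>\<sigma> | length \<sigma> = n. (norm (fold G \<sigma> x))\<^sup>2)) \<longlonglongrightarrow> K\<^sup>2 * 0"
    by (intro tendsto_mult_left stable_tendsto G)
  ultimately have "(norm (\<Delta> x))\<^sup>2 \<le> K\<^sup>2 * 0"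
    by (intro LIMSEQ_le_const) auto
  then show ?thesis by simp
qed

lemma gramian_difference_sqrt:
  fixes U V :: "'x::complex_hilbert \<Rightarrow> 'y::complex_hilbert"
  assumes U: "bounded_clinear U" and V: "bounded_clinear V" and le: "\<And>x. norm (V x) \<le> norm (U x)"
  shows "\<exists>R :: 'x \<Rightarrow> 'x. bounded_clinear R \<and> (\<forall>x. (norm (R x))\<^sup>2 = (norm (U x))\<^sup>2 - (norm (V x))\<^sup>2)"
proof -
  define D where "D x = U\<dagger> (U x) - V\<dagger> (V x)" for x
  have cl: "bounded_clinear D"
    unfolding D_def by (intro bounded_clinear_minus
        bounded_clinear_compose[OF bounded_clinear_cadjoint[OF U] U]
        bounded_clinear_compose[OF bounded_clinear_cadjoint[OF V] V])
  have iD: "inner (D x) y = inner (U x) (U y) - inner (V x) (V y)" for x y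
    unfolding D_def inner_diff_left unfolding inner_eq_Re_cinner cinner_cadjoint'[OF U] cinner_cadjoint'[OF V] ..
  have Dxx: "inner (D x) x = (norm (U x))\<^sup>2 - (norm (V x))\<^sup>2" for x
    by (simp add: iD power2_norm_eq_inner)
  obtain R where R: "bounded_linear R" "\<forall>x y. inner (R x) y = inner x (R y)" "\<forall>x. R (R x) = D x"
    and comm: "\<forall>J. bounded_linear J \<longrightarrow> (\<forall>x. D (J x) = J (D x)) \<longrightarrow> (\<forall>x. R (J x) = J (R x))"
  proof (rule exE[OF positive_operator_sqrt[OF bounded_clinear_linear[OF cl]]])
    show "inner (D x) y = inner x (D y)" for x y
      unfolding iD inner_commute[of x "D y"] inner_commute[of "U y"] inner_commute[of "V y"] ..
    show "0 \<le> inner (D x) x" for x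
      unfolding Dxx using power_mono[OF le[of x], of 2] by simp
  qed blast
  have "R (c *\<^sub>C x) = c *\<^sub>C R x" for c x
    using comm[rule_format, OF bounded_linear_scaleC[of c], of x] bounded_clinear_scaleC[OF cl]
    by blast
  then have "bounded_clinear R" using R(1) by (simp add: bounded_clinear_def)
  moreover have "(norm (R x))\<^sup>2 = (norm (U x))\<^sup>2 - (norm (V x))\<^sup>2" for x
  proof -
    have "(norm (R x))\<^sup>2 = inner (R (R x)) x"
      unfolding power2_norm_eq_inner using R(2) by simp
    also have "\<dots> = (norm (U x))\<^sup>2 - (norm (V x))\<^sup>2" using R(3) Dxx by simp
    finally show ?thesis .
  qed
  ultimately show ?thesis by blast
qed

text \<open>\<open>V\<close> is the adjoint of a contraction \<open>W : \<K>\<^sup>N \<oplus> \<E> \<rightarrow> \<K> \<oplus> \<E>\<close>, read as a system with state space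
  \<open>\<K>\<close>. The state reached under the input \<open>y\<close> is \<open>\<kappa> y\<close>, the output at the root is \<open>\<zeta> y\<close>.\<close>

lemma contractive_system:
  fixes V :: "'k::complex_hilbert \<times> 'e::complex_hilbert \<Rightarrow> ('n::finite, 'k) hsum \<times> 'e"
  assumes V: "bounded_clinear V" and contr: "\<And>y. norm (V y) \<le> norm y"
  shows "\<exists>\<kappa> :: ('n, 'e) fock \<Rightarrow> 'k. \<exists>\<zeta> :: ('n, 'e) fock \<Rightarrow> 'e. bounded_clinear \<kappa> \<and> bounded_clinear \<zeta> \<and>
    column bshift \<zeta> \<in> Schur \<and> (\<forall>y \<sigma>. column bshift \<zeta> y $$ \<sigma> = \<zeta> (fold bshift \<sigma> y)) \<and>
    (\<forall>y. V\<dagger> (Abs_hsum (\<lambda>a. \<kappa> (bshift a y)), y $$ []) = (\<kappa> y, \<zeta> y))"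
proof -
  \<comment> \<open>\<open>A\<close> and \<open>B\<close> are the adjoints of the blocks of
    \<open>W\<close> that produce the new state.\<close>
  define A where "A a k = fst (V (k, 0)) $$ a" for a k
  define B where "B k = snd (V (k, 0))" for k
  have Vl: "bounded_clinear (\<lambda>k. V (k, 0))"
    by (rule bounded_clinear_compose[OF V bounded_clinear_Pair_left])
  have A: "bounded_clinear (A a)" for a
    unfolding A_def by (rule bounded_clinear_compose[OF bounded_clinear_hnth
          bounded_clinear_compose[OF bounded_clinear_fst Vl]])
  have B: "bounded_clinear B"
    unfolding B_def by (rule bounded_clinear_compose[OF bounded_clinear_snd Vl])
  have "(norm (B k))\<^sup>2 + (\<Sum>a\<in>UNIV. (norm (A a k))\<^sup>2) \<le> (norm k)\<^sup>2" for k
  proof -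
    have "(norm (B k))\<^sup>2 + (\<Sum>a\<in>UNIV. (norm (A a k))\<^sup>2) = (norm (V (k, 0)))\<^sup>2"
      unfolding norm2_prod A_def B_def by (simp add: norm2_hsum)
    also have "\<dots> \<le> (norm (k, 0::'e))\<^sup>2" by (intro power_mono contr) simp
    finally show ?thesis by (simp add: norm_Pair)
  qed
  from sum_words_potential[where \<psi>="\<lambda>k. (norm k)\<^sup>2", OF zero_le_power2 this]
  have bound: "(\<Sum>n<m. \<Sum>\<sigma> | length \<sigma> = n. (norm (B (fold A \<sigma> k)))\<^sup>2) \<le> 1\<^sup>2 * (norm k)\<^sup>2" for m k
    by simp
  define \<kappa>' where "\<kappa>' = column A B"
  note \<kappa>'_nth = hnth_column[OF A B zero_le_one bound, folded \<kappa>'_def]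
  note \<kappa>'_norm = norm_column[OF A B zero_le_one bound, folded \<kappa>'_def]
  note \<kappa>'_cl = bounded_clinear_column[OF A B zero_le_one bound, folded \<kappa>'_def]
  have \<kappa>'_shift: "bshift a (\<kappa>' k) = \<kappa>' (A a k)" for a k
    by (rule hsum_eqI) (simp add: hnth_bshift \<kappa>'_nth)
  \<comment> \<open>The state recursion runs from longer words to shorter ones and has no starting
    point; the adjoint of the observability operator of \<open>(A, B)\<close> provides a bounded
    solution.\<close>
  define \<kappa> where "\<kappa> = \<kappa>'\<dagger>"
  have \<kappa>_cl: "bounded_clinear \<kappa>"
    unfolding \<kappa>_def by (rule bounded_clinear_cadjoint[OF \<kappa>'_cl])
  have \<kappa>_inner: "cinner (\<kappa> y) k = cinner y (\<kappa>' k)" for y k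
    unfolding \<kappa>_def by (rule cinner_cadjoint'[OF \<kappa>'_cl])
  have \<kappa>_norm: "norm (\<kappa> y) \<le> 1 * norm y" for y
    unfolding \<kappa>_def by (rule norm_adjoint_le[OF cinner_cadjoint[OF \<kappa>'_cl] zero_le_one \<kappa>'_norm])
  define inp where "inp y = (Abs_hsum (\<lambda>a. \<kappa> (bshift a y)), y $$ [])" for y
  have inp_cl: "bounded_clinear inp"
    unfolding inp_def
    by (rule bounded_clinear_inputs[OF bounded_clinear_compose[OF \<kappa>_cl bounded_clinear_bshift]
          bounded_clinear_hnth])
  have Vd: "bounded_clinear (V\<dagger>)" by (rule bounded_clinear_cadjoint[OF V])
  have Vd_norm: "norm (V\<dagger> w) \<le> 1 * norm w" for w
    by (rule norm_adjoint_le[OF cinner_cadjoint[OF V] zero_le_one]) (simp add: contr)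
  \<comment> \<open>The rule \<open>\<kappa>'_shift\<close> and the splitting
    \<open>cinner_fock\<close>, read through adjoints, are the state equation.\<close>
  have state: "fst (V\<dagger> (inp y)) = \<kappa> y" for y
  proof (rule eq_if_inner_eq)
    fix k
    have "cinner (fst (V\<dagger> (inp y))) k = cinner (V\<dagger> (inp y)) (k, 0)"
      by (simp add: cinner_prod_def)
    also have "\<dots> = cinner (inp y) (V (k, 0))" by (rule cinner_cadjoint'[OF V])
    also have "\<dots> = (\<Sum>a\<in>UNIV. cinner (\<kappa> (bshift a y)) (A a k)) + cinner (y $$ []) (B k)"
      by (simp add: cinner_prod_def inp_def cinner_Abs_finite A_def B_def)
    also have "\<dots> = cinner y (\<kappa>' k)"
      unfolding cinner_fock[of y] \<kappa>'_shift \<kappa>_inner \<kappa>'_nth by simp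
    also have "\<dots> = cinner (\<kappa> y) k" by (rule \<kappa>_inner[symmetric])
    finally show "inner (fst (V\<dagger> (inp y))) k = inner (\<kappa> y) k" by (simp add: inner_eq_Re_cinner)
  qed
  define \<zeta> where "\<zeta> y = snd (V\<dagger> (inp y))" for y
  have \<zeta>_cl: "bounded_clinear \<zeta>"
    unfolding \<zeta>_def
    by (rule bounded_clinear_compose[OF bounded_clinear_snd bounded_clinear_compose[OF Vd inp_cl]])
  \<comment> \<open>The storage function for the outputs is the input energy not held in the state;
    it is nonnegative because \<open>\<kappa>\<close> is a contraction.\<close>
  define \<psi> where "\<psi> y = (norm y)\<^sup>2 - (norm (\<kappa> y))\<^sup>2" for y
  have energy: "(norm (\<kappa> y))\<^sup>2 + (norm (\<zeta> y))\<^sup>2 \<le> (\<Sum>a\<in>UNIV. (norm (\<kappa> (bshift a y)))\<^sup>2) + (norm (y $$ []))\<^sup>2" for y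
  proof -
    have "(norm (\<kappa> y))\<^sup>2 + (norm (\<zeta> y))\<^sup>2 = (norm (V\<dagger> (inp y)))\<^sup>2"
      by (simp add: norm2_prod state \<zeta>_def)
    also have "\<dots> \<le> (norm (inp y))\<^sup>2"
      using Vd_norm[of "inp y"] by (intro power_mono) auto
    finally show ?thesis by (simp add: norm2_prod inp_def norm2_Abs_finite)
  qed
  have pos: "0 \<le> \<psi> y" for y
    unfolding \<psi>_def using \<kappa>_norm[of y] by (simp add: power_mono)
  have "(norm (\<zeta> y))\<^sup>2 + (\<Sum>a\<in>UNIV. \<psi> (bshift a y)) \<le> \<psi> y" for y
    unfolding \<psi>_def sum_subtractf norm2_fock[of y] using energy[of y] by simp
  from sum_words_potential[of \<psi>, OF pos this]
  have bound2: "(\<Sum>n<m. \<Sum>\<sigma> | length \<sigma> = n. (norm (\<zeta> (fold bshift \<sigma> y)))\<^sup>2) \<le> 1\<^sup>2 * (norm y)\<^sup>2" for m y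
    by (rule order_trans) (simp add: \<psi>_def)
  note T_nth = hnth_column[OF bounded_clinear_bshift \<zeta>_cl zero_le_one bound2]
  note T_norm = norm_column[OF bounded_clinear_bshift \<zeta>_cl zero_le_one bound2]
  note T_cl = bounded_clinear_column[OF bounded_clinear_bshift \<zeta>_cl zero_le_one bound2]
  have "bshift a (column bshift \<zeta> y) = column bshift \<zeta> (bshift a y)" for a y
    by (rule hsum_eqI) (simp add: hnth_bshift T_nth)
  then have "column bshift \<zeta> \<in> UT" using T_cl by (simp add: UT_iff)
  then have "column bshift \<zeta> \<in> Schur" using T_norm by (simp add: Schur_def)
  moreover have "V\<dagger> (Abs_hsum (\<lambda>a. \<kappa> (bshift a y)), y $$ []) = (\<kappa> y, \<zeta> y)" for y
    using state[of y] by (simp add: inp_def \<zeta>_def prod_eq_iff)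
  ultimately show ?thesis using \<kappa>_cl \<zeta>_cl T_nth by blast
qed

text \<open>With \<open>R\<^sup>*R = U\<^sup>*U - V\<^sup>*V\<close> for the two columns \<open>U\<close>, \<open>V\<close>, the map from \<open>((R G\<^sub>a x)\<^sub>a, u x)\<close> to
  \<open>(R x, v x)\<close> is isometric; the required \<open>T\<close> is the transfer operator of its contractive extension.\<close>

theorem schur_intertwining:
  fixes G :: "'n::finite \<Rightarrow> 'x::complex_hilbert \<Rightarrow> 'x" and u v :: "'x \<Rightarrow> 'e::complex_hilbert"
  assumes G: "stable G" and u: "bounded_clinear u" and v: "bounded_clinear v"
    and le: "\<And>x. norm (column G v x) \<le> norm (column G u x)"
  shows "\<exists>T\<in>Schur. \<forall>x. T (column G u x) = column G v x"
proof -
  note Gcl = stable_bounded_clinear[OF G]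
  note U_cl = bounded_clinear_column_stable[OF G u]
  note V_cl = bounded_clinear_column_stable[OF G v]
  obtain R :: "'x \<Rightarrow> 'x" where R: "bounded_clinear R"
    and Rn: "\<And>x. (norm (R x))\<^sup>2 = (norm (column G u x))\<^sup>2 - (norm (column G v x))\<^sup>2"
    using gramian_difference_sqrt[OF U_cl V_cl le] by blast
  define P where "P x = (Abs_hsum (\<lambda>a. R (G a x)), u x)" for x
  define Q where "Q x = (R x, v x)" for x
  have P: "bounded_clinear P"
    unfolding P_def by (rule bounded_clinear_inputs[OF bounded_clinear_compose[OF R Gcl] u])
  have Q: "bounded_clinear Q"
    unfolding Q_def bounded_clinear_def scaleC_prod_def
    using bounded_linear_Pair[OF bounded_clinear_linear[OF R] bounded_clinear_linear[OF v]]
    by (simp add: bounded_clinear_scaleC[OF R] bounded_clinear_scaleC[OF v])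
  \<comment> \<open>Both column norms split into a root term and shifted terms by
    \<open>norm2_fock\<close>; the shifted terms combine to the squared norms of
    \<open>R (G a x)\<close>, which gives the energy balance.\<close>
  have "(norm (Q x))\<^sup>2 = (norm (P x))\<^sup>2" for x
    unfolding norm2_prod Q_def P_def fst_conv snd_conv norm2_Abs_finite Rn
      norm2_fock[of "column G u x"] norm2_fock[of "column G v x"]
      bshift_column[OF G u] bshift_column[OF G v] hnth_column_stable[OF G u] hnth_column_stable[OF G v]
    by (simp add: sum_subtractf)
  then have QP: "norm (Q x) \<le> 1 * norm (P x)" for x
    by (simp add: power2_eq_iff_nonneg)
  \<comment> \<open>\<open>V\<close> is the adjoint of a contraction that extends
    \<open>P x \<mapsto> Q x\<close> from the range of \<open>P\<close> to the whole space.\<close>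
  obtain V where V: "bounded_clinear V" and VQ: "\<forall>x y. cinner (Q x) y = cinner (P x) (V y)"
    and Vn: "\<forall>y. norm (V y) \<le> 1 * norm y"
    using douglas_adjoint[OF P Q zero_le_one QP] by blast
  have VP: "V\<dagger> (P x) = Q x" for x
  proof (rule eq_if_inner_eq)
    fix y
    show "inner (V\<dagger> (P x)) y = inner (Q x) y"
      unfolding inner_eq_Re_cinner cinner_cadjoint'[OF V] spec[OF spec[OF VQ]] ..
  qed
  have Vd: "bounded_clinear (V\<dagger>)" by (rule bounded_clinear_cadjoint[OF V])
  have Vd_norm: "norm (V\<dagger> w) \<le> 1 * norm w" for w
    by (rule norm_adjoint_le[OF cinner_cadjoint[OF V] zero_le_one spec[OF Vn]])
  have contr: "norm (V y) \<le> norm y" for y using spec[OF Vn, of y] by simp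
  obtain \<kappa> :: "('n, 'e) fock \<Rightarrow> 'x" and \<zeta> :: "('n, 'e) fock \<Rightarrow> 'e"
    where \<kappa>: "bounded_clinear \<kappa>" and T: "column bshift \<zeta> \<in> Schur"
    and T_nth: "\<And>y \<sigma>. column bshift \<zeta> y $$ \<sigma> = \<zeta> (fold bshift \<sigma> y)"
    and sys: "\<And>y. V\<dagger> (Abs_hsum (\<lambda>a. \<kappa> (bshift a y)), y $$ []) = (\<kappa> y, \<zeta> y)"
    using contractive_system[OF V contr] by blast
  \<comment> \<open>The difference between the state reached under the input
    \<open>column G u x\<close> and the desired state \<open>R x\<close>. Both satisfy the same
    state equation, so \<open>\<Delta>\<close> satisfies it with zero input and vanishes by
    stability.\<close>
  define \<Delta> where "\<Delta> x = \<kappa> (column G u x) - R x" for x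
  have \<Delta>_cl: "bounded_clinear \<Delta>"
    unfolding \<Delta>_def by (intro bounded_clinear_minus bounded_clinear_compose[OF \<kappa> U_cl] R)
  have sysU: "V\<dagger> (Abs_hsum (\<lambda>a. \<kappa> (column G u (G a x))), u x) = (\<kappa> (column G u x), \<zeta> (column G u x))" for x
    using sys[of "column G u x"] by (simp add: bshift_column[OF G u] hnth_column_stable[OF G u])
  have "\<Delta> x = 0" for x
  proof (rule zero_if_stable_decreasing[OF G \<Delta>_cl])
    fix x
    have "(Abs_hsum (\<lambda>a. \<kappa> (column G u (G a x))), u x) - P x = (Abs_hsum (\<lambda>a. \<Delta> (G a x)), 0)"
      by (auto intro!: hsum_eqI simp: P_def \<Delta>_def hnth_Abs_finite)
    then have "V\<dagger> (Abs_hsum (\<lambda>a. \<Delta> (G a x)), 0) = (\<kappa> (column G u x), \<zeta> (column G u x)) - Q x"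
      using bounded_clinear_diff[OF Vd, of "(Abs_hsum (\<lambda>a. \<kappa> (column G u (G a x))), u x)" "P x"]
      by (simp add: sysU VP)
    then have "\<Delta> x = fst (V\<dagger> (Abs_hsum (\<lambda>a. \<Delta> (G a x)), 0))"
      by (simp add: \<Delta>_def Q_def)
    also have "(norm \<dots>)\<^sup>2 \<le> (norm (V\<dagger> (Abs_hsum (\<lambda>a. \<Delta> (G a x)), 0)))\<^sup>2"
      unfolding norm2_prod by simp
    also have "\<dots> \<le> (norm (Abs_hsum (\<lambda>a. \<Delta> (G a x)), 0 :: 'e))\<^sup>2"
      using Vd_norm[of "(Abs_hsum (\<lambda>a. \<Delta> (G a x)), 0)"] by (intro power_mono) auto
    also have "\<dots> = (\<Sum>a\<in>UNIV. (norm (\<Delta> (G a x)))\<^sup>2)"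
      by (simp add: norm2_prod norm2_Abs_finite)
    finally show "(norm (\<Delta> x))\<^sup>2 \<le> (\<Sum>a\<in>UNIV. (norm (\<Delta> (G a x)))\<^sup>2)" .
  qed
  then have "\<kappa> (column G u x) = R x" for x by (simp add: \<Delta>_def)
  then have \<zeta>: "\<zeta> (column G u x) = v x" for x
    using sysU[of x] VP[of x] by (simp add: P_def Q_def)
  have "column bshift \<zeta> (column G u x) = column G v x" for x
  proof (rule hsum_eqI)
    fix \<sigma>
    have "fold bshift \<sigma> (column G u x) = column G u (fold G \<sigma> x)"
      using fold_commute_apply[of "column G u" G bshift \<sigma> x] bshift_column[OF G u] by metis
    then show "column bshift \<zeta> (column G u x) $$ \<sigma> = column G v x $$ \<sigma>"
      by (simp add: T_nth \<zeta> hnth_column_stable[OF G v])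
  qed
  then show ?thesis using T by blast
qed

section \<open>Block operators\<close>

text \<open>For A = I - (Z|Z) one has 0 \<le> A \<le> I, hence A squared is at most A. A bound
  \<open>K\<close> for the inverse then gives
  \<open>(norm x)\<^sup>2 \<le> K\<^sup>2 * inner (A x) x\<close>, so (Z|Z) is at most
  \<open>1 - 1 / K\<^sup>2\<close>.\<close>

lemma Z_ball_strict:
  fixes Z :: "'n::finite \<Rightarrow> 'e::complex_hilbert \<Rightarrow> 'e"
  assumes Z: "Z \<in> Z_ball"
  shows "\<exists>\<rho>. 0 \<le> \<rho> \<and> \<rho> < 1 \<and> (\<forall>x. (\<Sum>k\<in>UNIV. (norm (Z k x))\<^sup>2) \<le> \<rho> * (norm x)\<^sup>2)"
proof -
  define A where "A x = x - (\<Sum>k\<in>UNIV. (Z k)\<dagger> (Z k x))" for x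
  have cl: "bounded_clinear (Z k)" for k
    using Z by (simp add: Z_ball_def)
  have "positive_on UNIV A" "boundedly_invertible A"
    using Z by (simp_all add: Z_ball_def Let_def A_def[abs_def])
  then obtain B where pos: "\<And>x. cinner (A x) x \<in> \<real>\<^sub>\<ge>\<^sub>0" and A: "bounded_clinear A"
    and B: "bounded_clinear B" and BA: "\<And>x. B (A x) = x"
    by (auto simp: positive_on_def boundedly_invertible_def o_def id_def fun_eq_iff)
  have iA: "inner (A x) y = inner x y - (\<Sum>k\<in>UNIV. inner (Z k x) (Z k y))" for x y
    unfolding A_def inner_diff_left inner_sum_left
    unfolding inner_eq_Re_cinner cinner_cadjoint'[OF cl] ..
  have iAx: "inner (A x) x = (norm x)\<^sup>2 - (\<Sum>k\<in>UNIV. (norm (Z k x))\<^sup>2)" for x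
    by (simp add: iA power2_norm_eq_inner)
  obtain K where K: "K > 0" "\<And>x. norm (B x) \<le> K * norm x"
    using bounded_clinear_bound[OF B] by metis
  have main: "(norm x)\<^sup>2 \<le> K\<^sup>2 * ((norm x)\<^sup>2 - (\<Sum>k\<in>UNIV. (norm (Z k x))\<^sup>2))" for x
  proof -
    have "(norm x)\<^sup>2 \<le> K\<^sup>2 * (norm (A x))\<^sup>2"
      using power_mono[OF K(2)[of "A x"], of 2] by (simp add: BA power_mult_distrib)
    also have "(norm (A x))\<^sup>2 \<le> 1 * inner (A x) x"
    proof (rule positive_operator_norm_le)
      show "linear A" using bounded_clinear_linear[OF A] by (rule bounded_linear.linear)
      show "inner (A x) y = inner x (A y)" for x y
        unfolding inner_commute[of x "A y"] iA inner_commute[of y x]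
        by (simp add: inner_commute)
      show "0 \<le> inner (A x) x" for x
        using pos[of x] by (simp add: inner_eq_Re_cinner complex_nonneg_Reals_iff)
      show "inner (A x) x \<le> 1 * (norm x)\<^sup>2" for x
        unfolding iAx by (simp add: sum_nonneg)
    qed
    finally show ?thesis unfolding iAx by (simp add: mult_left_mono)
  qed
  \<comment> \<open>The maximum with 0 covers the zero space, where \<open>K\<close> may be less
    than 1.\<close>
  define \<rho> where "\<rho> = max 0 (1 - 1 / K\<^sup>2)"
  have "(\<Sum>k\<in>UNIV. (norm (Z k x))\<^sup>2) \<le> \<rho> * (norm x)\<^sup>2" for x
  proof -
    have "(norm x)\<^sup>2 / K\<^sup>2 \<le> (norm x)\<^sup>2 - (\<Sum>k\<in>UNIV. (norm (Z k x))\<^sup>2)"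
      using main[of x] K(1) by (simp add: divide_le_eq mult.commute)
    then have "(\<Sum>k\<in>UNIV. (norm (Z k x))\<^sup>2) \<le> (1 - 1 / K\<^sup>2) * (norm x)\<^sup>2"
      by (simp add: left_diff_distrib)
    also have "\<dots> \<le> \<rho> * (norm x)\<^sup>2" unfolding \<rho>_def by (rule mult_right_mono) auto
    finally show ?thesis .
  qed
  then show ?thesis using K(1) by (intro exI[of _ \<rho>]) (auto simp: \<rho>_def)
qed

lemma hnth_block_op:
  "finite I \<Longrightarrow> block_op I M x $$ i = (if i \<in> I then \<Sum>j\<in>I. M i j (x $$ j) else 0)"
  unfolding block_op_def
  by (rule Abs_hsum_nth, rule finite_nonzero_values_imp_summable_on) (rule finite_subset[of _ I], auto)

lemma block_op_eq_sum:
  assumes "finite I"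
  shows "block_op I M x = (\<Sum>i\<in>I. hsingle i (\<Sum>j\<in>I. M i j (x $$ j)))"
  by (rule hsum_eqI) (simp add: hnth_block_op[OF assms] hnth_sum hnth_hsingle assms)

lemma bounded_clinear_block_op:
  assumes I: "finite I" and M: "\<And>i j. bounded_clinear (M i j)"
  shows "bounded_clinear (block_op I M)"
  unfolding block_op_eq_sum[OF I, abs_def]
  by (rule bounded_clinear_setsum, rule bounded_clinear_compose[OF bounded_clinear_hsingle],
      rule bounded_clinear_setsum, rule bounded_clinear_compose[OF M bounded_clinear_hnth])

lemma cinner_block_op:
  assumes I: "finite I" and M: "\<And>i j x y. cinner (M i j x) y = cinner x (M' j i y)"
  shows "cinner (block_op I M x) y = cinner x (block_op I M' y)"
  unfolding block_op_eq_sum[OF I] cinner_sum_left cinner_sum_right cinner_hsingle cinner_hsingle' M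
  by (rule sum.swap)

text \<open>The adjoints of the operators \<open>F\<^sub>k\<^sup>(\<^sup>l\<^sup>)\<close> (with \<open>s k \<tau> = \<tau> @ [k]\<close>) and of their scalar
  counterparts on \<open>\<E>\<^sup>\<oplus>\<^sup>(\<^sup>l\<^sup>+\<^sup>1\<^sup>)\<close> (with \<open>s k = Suc\<close>).\<close>

definition backward :: "'i set \<Rightarrow> ('n \<Rightarrow> 'i \<Rightarrow> 'i) \<Rightarrow> ('n \<Rightarrow> 'e \<Rightarrow> 'e) \<Rightarrow> 'n \<Rightarrow>
    ('i, 'e::complex_hilbert) hsum \<Rightarrow> ('i, 'e) hsum" where
  "backward I s Z k = block_op I (\<lambda>j i. if i = j then Z k else if i = s k j then id else (\<lambda>_. 0))"

lemma hnth_backward: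
  assumes "finite I" and "s k j \<noteq> j"
  shows "backward I s Z k x $$ j =
    (if j \<in> I then Z k (x $$ j) + (if s k j \<in> I then x $$ s k j else 0) else 0)"
proof -
  have "(\<Sum>i\<in>I. (if i = j then Z k else if i = s k j then id else (\<lambda>_. 0)) (x $$ i))
      = (\<Sum>i\<in>I. (if i = j then Z k (x $$ i) else 0) + (if i = s k j then x $$ i else 0))"
    using assms(2) by (intro sum.cong) auto
  then show ?thesis
    unfolding backward_def hnth_block_op[OF assms(1)] using assms(1) by (simp add: sum.distrib)
qed

lemma bounded_clinear_backward:
  assumes "finite I" and "bounded_clinear (Z k)"
  shows "bounded_clinear (backward I s Z k)"
  unfolding backward_def
  by (rule bounded_clinear_block_op[OF assms(1)])
    (simp add: assms(2) bounded_clinear_const_zero bounded_clinear_id id_def)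

lemma cinner_backward:
  assumes "finite I" and Z: "bounded_clinear (Z k)"
  shows "cinner (block_op I (\<lambda>i j. if i = j then (Z k)\<dagger> else if i = s k j then id else (\<lambda>_. 0)) x) y
    = cinner x (backward I s Z k y)"
  unfolding backward_def
  by (rule cinner_block_op[OF assms(1)]) (auto simp: cinner_cadjoint'[OF Z])

text \<open>\<open>\<nu>\<close> is a Lyapunov function. It has to dominate the norm only on the
  ranges of the \<open>G a\<close>, because in the application it ignores blocks outside a finite
  index set; words of length 0 are covered by \<open>1 \<le> C\<close>.\<close>

lemma stableI:
  fixes G :: "'n::finite \<Rightarrow> 'x::complex_hilbert \<Rightarrow> 'x"
  assumes cl: "\<And>a. bounded_clinear (G a)" and C: "1 \<le> C" and q: "0 \<le> q" "q < 1"
    and upper: "\<And>x. \<nu> x \<le> C * (norm x)\<^sup>2" and lower: "\<And>a x. (norm (G a x))\<^sup>2 \<le> \<nu> (G a x)"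
    and step: "\<And>x. (\<Sum>a\<in>UNIV. \<nu> (G a x)) \<le> q * \<nu> x"
  shows "stable G"
proof -
  have dec: "(\<Sum>\<sigma> | length \<sigma> = n. \<nu> (fold G \<sigma> x)) \<le> q ^ n * \<nu> x" for n x
  proof (induction n)
    case (Suc n)
    have "(\<Sum>\<sigma> | length \<sigma> = Suc n. \<nu> (fold G \<sigma> x)) \<le> q * (\<Sum>\<sigma> | length \<sigma> = n. \<nu> (fold G \<sigma> x))"
      unfolding sum_words_Suc' sum_distrib_left by (intro sum_mono) (simp add: step)
    also have "\<dots> \<le> q * (q ^ n * \<nu> x)" by (intro mult_left_mono Suc q)
    finally show ?case by simp
  qed simp
  have "(\<Sum>\<sigma> | length \<sigma> = n. (norm (fold G \<sigma> x))\<^sup>2) \<le> C * q ^ n * (norm x)\<^sup>2" for n x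
  proof (cases n)
    case 0
    then show ?thesis using mult_right_mono[OF C, of "(norm x)\<^sup>2"] by simp
  next
    case (Suc m)
    have "(\<Sum>\<sigma> | length \<sigma> = n. (norm (fold G \<sigma> x))\<^sup>2) \<le> (\<Sum>\<sigma> | length \<sigma> = n. \<nu> (fold G \<sigma> x))"
      unfolding Suc sum_words_Suc' by (intro sum_mono) (simp add: lower)
    also have "\<dots> \<le> q ^ n * \<nu> x" by (rule dec)
    also have "\<dots> \<le> q ^ n * (C * (norm x)\<^sup>2)" by (intro mult_left_mono upper) (simp add: q)
    finally show ?thesis by (simp add: mult_ac)
  qed
  then show ?thesis
    unfolding stable_def using cl C q by (intro conjI allI exI[of _ C] exI[of _ q]) auto
qed

text \<open>Young's inequality: the product of the norms is written as
  \<open>(r * norm a) * (norm b / r)\<close> with \<open>r\<close> the square root of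
  \<open>\<epsilon>\<close>.\<close>

lemma norm2_add_le_weighted:
  assumes "\<epsilon> > 0"
  shows "(norm (a + b))\<^sup>2 \<le> (1 + \<epsilon>) * (norm a)\<^sup>2 + (1 + 1 / \<epsilon>) * (norm (b::'a::real_normed_vector))\<^sup>2"
proof -
  define r where "r = sqrt \<epsilon>"
  have r: "r > 0" "\<epsilon> = r * r" using assms by (auto simp: r_def)
  have "(norm (a + b))\<^sup>2 \<le> (norm a + norm b)\<^sup>2"
    by (intro power_mono norm_triangle_ineq) simp
  also have "\<dots> = (norm a)\<^sup>2 + (norm b)\<^sup>2 + 2 * ((r * norm a) * (norm b / r))"
    using r by (simp add: power2_sum)
  also have "\<dots> \<le> (norm a)\<^sup>2 + (norm b)\<^sup>2 + ((r * norm a)\<^sup>2 + (norm b / r)\<^sup>2)"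
    using sum_squares_bound[of "r * norm a" "norm b / r"] by (simp only: mult.assoc add_left_mono)
  also have "\<dots> = (1 + \<epsilon>) * (norm a)\<^sup>2 + (1 + 1 / \<epsilon>) * (norm b)\<^sup>2"
    unfolding r(2) by (simp add: power2_eq_square algebra_simps)
  finally show ?thesis .
qed

text \<open>Giving the block \<open>i\<close> the weight \<open>w\<close> to the power \<open>rk i\<close> with a large \<open>w\<close> makes the
  off-diagonal part small, so that the strict contraction on the diagonal dominates.\<close>

lemma stable_backward:
  fixes Z :: "'n::finite \<Rightarrow> 'e::complex_hilbert \<Rightarrow> 'e" and s :: "'n \<Rightarrow> 'i \<Rightarrow> 'i"
  assumes I: "finite I" and Z: "\<And>k. bounded_clinear (Z k)" and \<rho>: "0 \<le> \<rho>" "\<rho> < 1"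
    and ZZ: "\<And>x. (\<Sum>k\<in>UNIV. (norm (Z k x))\<^sup>2) \<le> \<rho> * (norm x)\<^sup>2"
    and rk: "\<And>k i. rk (s k i) = Suc (rk i)" and inj: "\<And>k. inj (s k)"
  shows "stable (backward I s Z)"
proof -
  \<comment> \<open>The total factor will be at most
    \<open>\<rho> + \<epsilon> + (1 - \<rho>) / 4 = q\<close>. The weight \<open>w\<close> is chosen
    for the last summand, and its \<open>+ 1\<close> ensures \<open>w \<ge> 1\<close>.\<close>
  define \<epsilon> where "\<epsilon> = (1 - \<rho>) / 2"
  define N where "N = real CARD('n)"
  define w where "w = 4 * N * (1 + 1 / \<epsilon>) / (1 - \<rho>) + 1"
  define q where "q = (3 + \<rho>) / 4"
  define \<nu> where "\<nu> x = (\<Sum>i\<in>I. w ^ rk i * (norm (x $$ i))\<^sup>2)" for x :: "('i, 'e) hsum"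
  have \<epsilon>: "\<epsilon> > 0" using \<rho> by (simp add: \<epsilon>_def)
  have N: "N \<ge> 0" by (simp add: N_def)
  have w: "w \<ge> 1" using \<epsilon> \<rho> N by (simp add: w_def)
  have ne: "s k i \<noteq> i" for k i using rk[of k i] by auto
  note nth = hnth_backward[OF I, where s=s, OF ne]
  have \<nu>0: "0 \<le> \<nu> x" for x unfolding \<nu>_def using w by (intro sum_nonneg mult_nonneg_nonneg) auto
  define C where "C = (\<Sum>i\<in>I. w ^ rk i) + 1"
  have C: "1 \<le> C" unfolding C_def using w by (simp add: sum_nonneg)
  show ?thesis
  proof (rule stableI[where \<nu>=\<nu>])
    show "bounded_clinear (backward I s Z k)" for k by (rule bounded_clinear_backward[OF I Z])
    show "1 \<le> C" by (rule C)
    show "0 \<le> q" "q < 1" using \<rho> by (auto simp: q_def)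
    show "\<nu> x \<le> C * (norm x)\<^sup>2" for x
    proof -
      have "\<nu> x \<le> (\<Sum>i\<in>I. w ^ rk i * (norm x)\<^sup>2)"
        unfolding \<nu>_def using w by (intro sum_mono mult_left_mono power_mono norm_hnth_le) auto
      also have "\<dots> \<le> C * (norm x)\<^sup>2" by (simp add: C_def sum_distrib_right[symmetric] distrib_right)
      finally show ?thesis .
    qed
    show "(norm (backward I s Z k x))\<^sup>2 \<le> \<nu> (backward I s Z k x)" for k x
    proof -
      have "(norm (backward I s Z k x))\<^sup>2 = (\<Sum>\<^sub>\<infinity>i\<in>I. (norm (backward I s Z k x $$ i))\<^sup>2)"
        unfolding norm2_hsum by (rule infsum_cong_neutral) (auto simp: nth)
      also have "\<dots> = (\<Sum>i\<in>I. (norm (backward I s Z k x $$ i))\<^sup>2)"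
        using I by simp
      also have "\<dots> \<le> \<nu> (backward I s Z k x)"
        unfolding \<nu>_def
      proof (rule sum_mono)
        fix i
        show "(norm (backward I s Z k x $$ i))\<^sup>2 \<le> w ^ rk i * (norm (backward I s Z k x $$ i))\<^sup>2"
          using mult_right_mono[OF one_le_power[OF w, of "rk i"], of "(norm (backward I s Z k x $$ i))\<^sup>2"]
          by simp
      qed
      finally show ?thesis .
    qed
    show "(\<Sum>k\<in>UNIV. \<nu> (backward I s Z k x)) \<le> q * \<nu> x" for x
    proof -
      define y where "y k i = (if s k i \<in> I then x $$ s k i else 0)" for k i
      \<comment> \<open>\<open>s k\<close> raises the rank by one, so reindexing along it gains a
        factor \<open>1 / w\<close>.\<close>
      have off: "(\<Sum>i\<in>I. w ^ rk i * (norm (y k i))\<^sup>2) \<le> \<nu> x / w" for k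
      proof -
        have "(\<Sum>i\<in>I. w ^ rk i * (norm (y k i))\<^sup>2)
            = (\<Sum>i\<in>{i\<in>I. s k i \<in> I}. w ^ rk (s k i) * (norm (x $$ s k i))\<^sup>2 / w)"
          using w by (intro sum.mono_neutral_cong_right I) (auto simp: y_def rk)
        also have "\<dots> = (\<Sum>j\<in>s k ` {i\<in>I. s k i \<in> I}. w ^ rk j * (norm (x $$ j))\<^sup>2 / w)"
          by (subst sum.reindex[OF inj_on_subset[OF inj]]) auto
        also have "\<dots> \<le> (\<Sum>j\<in>I. w ^ rk j * (norm (x $$ j))\<^sup>2 / w)"
          using w by (intro sum_mono2 I) auto
        finally show ?thesis by (simp add: \<nu>_def sum_divide_distrib)
      qed
      have "(\<Sum>k\<in>UNIV. \<nu> (backward I s Z k x))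
          = (\<Sum>k\<in>UNIV. \<Sum>i\<in>I. w ^ rk i * (norm (Z k (x $$ i) + y k i))\<^sup>2)"
        unfolding \<nu>_def by (intro sum.cong) (auto simp: nth y_def)
      also have "\<dots> \<le> (\<Sum>k\<in>UNIV. \<Sum>i\<in>I. w ^ rk i *
          ((1 + \<epsilon>) * (norm (Z k (x $$ i)))\<^sup>2 + (1 + 1 / \<epsilon>) * (norm (y k i))\<^sup>2))"
        using w by (intro sum_mono mult_left_mono norm2_add_le_weighted \<epsilon>) auto
      also have "\<dots> = (1 + \<epsilon>) * (\<Sum>i\<in>I. w ^ rk i * (\<Sum>k\<in>UNIV. (norm (Z k (x $$ i)))\<^sup>2))
          + (1 + 1 / \<epsilon>) * (\<Sum>k\<in>UNIV. \<Sum>i\<in>I. w ^ rk i * (norm (y k i))\<^sup>2)"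
        unfolding sum_distrib_left distrib_left sum.distrib
        by (subst sum.swap) (simp add: mult_ac)
      also have "\<dots> \<le> (1 + \<epsilon>) * (\<rho> * \<nu> x) + (1 + 1 / \<epsilon>) * (N * (\<nu> x / w))"
      proof (intro add_mono mult_left_mono)
        have "(\<Sum>i\<in>I. w ^ rk i * (\<Sum>k\<in>UNIV. (norm (Z k (x $$ i)))\<^sup>2))
            \<le> (\<Sum>i\<in>I. w ^ rk i * (\<rho> * (norm (x $$ i))\<^sup>2))"
          using w by (intro sum_mono mult_left_mono ZZ) auto
        then show "(\<Sum>i\<in>I. w ^ rk i * (\<Sum>k\<in>UNIV. (norm (Z k (x $$ i)))\<^sup>2)) \<le> \<rho> * \<nu> x"
          by (simp add: \<nu>_def sum_distrib_left mult_ac)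
        show "(\<Sum>k\<in>UNIV. \<Sum>i\<in>I. w ^ rk i * (norm (y k i))\<^sup>2) \<le> N * (\<nu> x / w)"
          unfolding N_def by (rule sum_bounded_above) (rule off)
      qed (use \<epsilon> in auto)
      also have "\<dots> = ((1 + \<epsilon>) * \<rho> + (1 + 1 / \<epsilon>) * N / w) * \<nu> x"
        by (simp add: algebra_simps)
      also have "\<dots> \<le> q * \<nu> x"
      proof (rule mult_right_mono[OF _ \<nu>0])
        have "\<epsilon> * \<rho> \<le> \<epsilon>" using \<rho> \<epsilon> by simp
        moreover have "(1 + 1 / \<epsilon>) * N / w \<le> (1 - \<rho>) / 4"
        proof -
          have "(1 + 1 / \<epsilon>) * N = (1 - \<rho>) / 4 * (w - 1)"
            using \<rho> by (simp add: w_def)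
          also have "\<dots> \<le> (1 - \<rho>) / 4 * w" using \<rho> by (intro mult_left_mono) auto
          finally show ?thesis using w by (simp add: divide_le_eq)
        qed
        ultimately show "(1 + \<epsilon>) * \<rho> + (1 + 1 / \<epsilon>) * N / w \<le> q"
          by (simp add: q_def \<epsilon>_def distrib_right) (simp add: field_simps)
      qed
      finally show ?thesis .
    qed
  qed
qed

section \<open>Adjoints of the operators in the statement\<close>

lemma cinner_word_op:
  assumes "\<And>k x y. cinner (F k x) y = cinner x (G k y)"
  shows "cinner (word_op F \<sigma> x) y = cinner x (fold G \<sigma> y)"
  by (induction \<sigma> arbitrary: x y) (simp_all add: assms)

text \<open>For a nonzero entry the recursion strips equal first letters until the column word is
  empty; what remains of the row word is then empty or the single letter \<open>k\<close>. Thus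
  \<open>k\<close> is appended at the end, although ampliation acts at the front.\<close>

lemma F_entry_eq:
  "F_entry Z k \<sigma> \<tau> = (if \<sigma> = \<tau> then (Z k)\<dagger> else if \<sigma> = \<tau> @ [k] then id else (\<lambda>_. 0))"
  by (induction Z k \<sigma> \<tau> rule: F_entry.induct) auto

lemma finite_words_le: "finite {\<sigma> :: 'n::finite list. length \<sigma> \<le> l}"
  using finite_lists_length_le[of "UNIV :: 'n set" l] by simp

lemma U_col_eq: "U_col = hsingle 0"
  unfolding U_col_def
  by (rule cadjoint_row_op[OF bounded_clinear_hsingle]) (simp add: hnth_hsingle)

lemma cinner_V_col:
  assumes B: "\<And>k. k \<le> l \<Longrightarrow> bounded_clinear (B k)"
  shows "cinner (V_col l B x) y = cinner x (\<Sum>k\<le>l. B k (y $$ k))"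
proof -
  have "V_col l B = (\<lambda>x. \<Sum>k\<le>l. hsingle k ((B k)\<dagger> x))"
    unfolding V_col_def
  proof (rule cadjoint_row_op)
    show "bounded_clinear (\<lambda>x. \<Sum>k\<le>l. hsingle k ((B k)\<dagger> x))"
      by (rule bounded_clinear_setsum,
          rule bounded_clinear_compose[OF bounded_clinear_hsingle bounded_clinear_cadjoint[OF B]]) simp
    fix i x y
    show "cinner ((if i \<le> l then B i else (\<lambda>_. 0)) x) y = cinner x ((\<Sum>k\<le>l. hsingle k ((B k)\<dagger> y)) $$ i)"
      by (simp add: hnth_sum hnth_hsingle cinner_cadjoint[OF B])
  qed
  then show ?thesis
    by (simp add: cinner_sum_left cinner_sum_right cinner_hsingle cinner_cadjoint'[OF B])
qed

abbreviation (input) back_nat :: "nat \<Rightarrow> ('n \<Rightarrow> 'e \<Rightarrow> 'e) \<Rightarrow> 'n \<Rightarrow>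
    (nat, 'e::complex_hilbert) hsum \<Rightarrow> (nat, 'e) hsum" where
  "back_nat l \<equiv> backward {..l} (\<lambda>_. Suc)"

abbreviation (input) back_words :: "nat \<Rightarrow> ('n::finite \<Rightarrow> 'e \<Rightarrow> 'e) \<Rightarrow> 'n \<Rightarrow>
    ('n, 'e::complex_hilbert) fock \<Rightarrow> ('n, 'e) fock" where
  "back_words l \<equiv> backward {\<sigma>. length \<sigma> \<le> l} (\<lambda>k \<sigma>. \<sigma> @ [k])"

lemma cinner_Ft_op: "bounded_clinear (Z k) \<Longrightarrow> cinner (Ft_op l Z k x) y = cinner x (back_nat l Z k y)"
  unfolding Ft_op_def by (rule cinner_backward) auto

lemma cinner_F_op: "bounded_clinear (Z k) \<Longrightarrow> cinner (F_op l Z k x) y = cinner x (back_words l Z k y)"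
  unfolding F_op_def F_entry_eq[abs_def] by (rule cinner_backward) (auto simp: finite_words_le)

context
  fixes Z :: "'n::finite \<Rightarrow> 'e::complex_hilbert \<Rightarrow> 'e"
  assumes Z: "Z \<in> Z_ball"
begin

lemma Z_bounded_clinear: "bounded_clinear (Z k)"
  using Z by (simp add: Z_ball_def)

lemma stable_back_nat: "stable (back_nat l Z)"
proof -
  obtain \<rho> where "0 \<le> \<rho>" "\<rho> < 1" "\<And>x. (\<Sum>k\<in>UNIV. (norm (Z k x))\<^sup>2) \<le> \<rho> * (norm x)\<^sup>2"
    using Z_ball_strict[OF Z] by blast
  then show ?thesis
    by (intro stable_backward[where rk="\<lambda>i. i"] Z_bounded_clinear) auto
qed

lemma stable_back_words: "stable (back_words l Z)"
proof -
  obtain \<rho> where "0 \<le> \<rho>" "\<rho> < 1" "\<And>x. (\<Sum>k\<in>UNIV. (norm (Z k x))\<^sup>2) \<le> \<rho> * (norm x)\<^sup>2"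
    using Z_ball_strict[OF Z] by blast
  then show ?thesis
    by (intro stable_backward[where rk=length] Z_bounded_clinear finite_words_le) (auto intro: injI)
qed

lemma U_inf_eq: "U_inf l Z = column (back_nat l Z) (\<lambda>x. x $$ 0)"
  unfolding U_inf_def
proof (rule cadjoint_row_op)
  show "bounded_clinear (column (back_nat l Z) (\<lambda>x. x $$ 0))"
    by (rule bounded_clinear_column_stable[OF stable_back_nat bounded_clinear_hnth])
  show "cinner ((word_op (Ft_op l Z) \<sigma> \<circ> U_col) x) y
      = cinner x (column (back_nat l Z) (\<lambda>x. x $$ 0) y $$ \<sigma>)" for \<sigma> x y
    by (simp add: hnth_column_stable[OF stable_back_nat bounded_clinear_hnth] U_col_eq cinner_hsingle
        cinner_word_op[OF cinner_Ft_op[OF Z_bounded_clinear]])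
qed

lemma V_inf_eq:
  assumes B: "\<And>k. k \<le> l \<Longrightarrow> bounded_clinear (B k)"
  shows "V_inf l Z B = column (back_nat l Z) (\<lambda>x. \<Sum>k\<le>l. B k (x $$ k))"
    and "bounded_clinear (\<lambda>x. \<Sum>k\<le>l. B k (x $$ k))"
proof -
  show v: "bounded_clinear (\<lambda>x. \<Sum>k\<le>l. B k (x $$ k))"
    by (rule bounded_clinear_setsum, rule bounded_clinear_compose[OF B bounded_clinear_hnth]) simp
  show "V_inf l Z B = column (back_nat l Z) (\<lambda>x. \<Sum>k\<le>l. B k (x $$ k))"
    unfolding V_inf_def
  proof (rule cadjoint_row_op)
    show "bounded_clinear (column (back_nat l Z) (\<lambda>x. \<Sum>k\<le>l. B k (x $$ k)))"
      by (rule bounded_clinear_column_stable[OF stable_back_nat v])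
    show "cinner ((word_op (Ft_op l Z) \<sigma> \<circ> V_col l B) x) y
        = cinner x (column (back_nat l Z) (\<lambda>x. \<Sum>k\<le>l. B k (x $$ k)) y $$ \<sigma>)" for \<sigma> x y
      by (simp add: hnth_column_stable[OF stable_back_nat v] cinner_V_col[OF B]
          cinner_word_op[OF cinner_Ft_op[OF Z_bounded_clinear]])
  qed
qed

text \<open>\<open>L_op \<tau> Z\<close> is the row operator followed by the projection to the block
  \<open>\<tau>\<close>; in the adjoint, the embedding \<open>hsingle \<tau>\<close> comes
  first.\<close>

lemma cadjoint_L_op:
  "(L_op \<tau> Z)\<dagger> = (\<lambda>x. column (back_words (length \<tau>) Z) (\<lambda>y. y $$ []) (hsingle \<tau> x))"
proof (rule cadjoint_eqI)
  fix x y
  let ?J = "column (back_words (length \<tau>) Z) (\<lambda>y. y $$ [])"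
  have J: "bounded_clinear ?J"
    by (rule bounded_clinear_column_stable[OF stable_back_words bounded_clinear_hnth])
  have "row_op (\<lambda>\<sigma>. word_op (F_op (length \<tau>) Z) \<sigma> \<circ> hsingle []) = ?J\<dagger>"
    by (rule row_op_eq_cadjoint[OF J])
      (simp add: hnth_column_stable[OF stable_back_words bounded_clinear_hnth] cinner_hsingle
        cinner_word_op[OF cinner_F_op[OF Z_bounded_clinear]])
  then have "cinner (L_op \<tau> Z x) y = cinner (?J\<dagger> x $$ \<tau>) y" by (simp add: L_op_def)
  also have "\<dots> = cinner x (?J (hsingle \<tau> y))"
    unfolding cinner_hsingle'[symmetric] by (rule cinner_cadjoint'[OF J])
  finally show "cinner (L_op \<tau> Z x) y = cinner x (?J (hsingle \<tau> y))" .
qed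

text \<open>Summing over the words of each length intertwines \<open>F\<^sub>k\<^sup>(\<^sup>m\<^sup>)\<close> with its scalar counterpart.\<close>

lemma sum_column_back_words:
  assumes m: "m \<le> l"
  shows "(\<Sum>\<tau> | length \<tau> = m. column (back_words m Z) (\<lambda>y. y $$ []) (hsingle \<tau> x))
    = U_inf l Z (hsingle m x)"
proof -
  let ?J = "column (back_words m Z) (\<lambda>y. y $$ [])"
  note zero = bounded_clinear_zero[OF Z_bounded_clinear]
  \<comment> \<open>\<open>y'\<close> depends on a word only through its length, and
    \<open>y\<close> is its profile. As \<open>y\<close> vanishes above \<open>m\<close>, the
    truncations at \<open>m\<close> for words and at \<open>l\<close> for numbers agree.\<close>
  define rel where "rel y' y \<longleftrightarrow> (\<forall>\<tau>. y' $$ \<tau> = (if length \<tau> \<le> m then y $$ length \<tau> else 0)) \<and> (\<forall>j>m. y $$ j = 0)"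
    for y' :: "('n, 'e) fock" and y :: "(nat, 'e) hsum"
  have step: "rel (back_words m Z k y') (back_nat l Z k y)" if "rel y' y" for k y' y
    using that m unfolding rel_def by (auto simp: hnth_backward finite_words_le zero)
  have fold: "rel (fold (back_words m Z) \<sigma> y') (fold (back_nat l Z) \<sigma> y)" if "rel y' y" for \<sigma> y' y
    using that by (induction \<sigma> arbitrary: y' y) (auto intro: step)
  define y' where "y' = (\<Sum>\<tau> | length \<tau> = m. hsingle \<tau> x :: ('n, 'e) fock)"
  have "y' $$ \<tau> = (if length \<tau> = m then x else 0)" for \<tau>
    by (simp add: y'_def hnth_sum hnth_hsingle finite_words)
  then have "rel y' (hsingle m x)" by (auto simp: rel_def hnth_hsingle)
  from fold[OF this] have "fold (back_words m Z) \<sigma> y' $$ [] = fold (back_nat l Z) \<sigma> (hsingle m x) $$ 0" for \<sigma>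
    by (simp add: rel_def)
  then have "?J y' = U_inf l Z (hsingle m x)"
    by (intro hsum_eqI) (simp add: U_inf_eq hnth_column_stable[OF stable_back_nat bounded_clinear_hnth]
        hnth_column_stable[OF stable_back_words bounded_clinear_hnth])
  then show ?thesis
    unfolding y'_def
      bounded_clinear_sum[OF bounded_clinear_column_stable[OF stable_back_words bounded_clinear_hnth]] .
qed

lemma total_deriv_eq:
  assumes T: "bounded_clinear T" and "k \<le> l"
  shows "total_deriv k T Z x = T (U_inf l Z (hsingle k x)) $$ []"
  unfolding total_deriv_def partial_deriv_def cadjoint_L_op sum_column_back_words[OF assms(2), symmetric]
    bounded_clinear_sum[OF T] hnth_sum
  by (rule sum.cong) auto

end

section \<open>Gramian positivity and the interpolation criterion\<close>

lemma positive_on_gramian_difference: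
  assumes U: "bounded_clinear U" and V: "bounded_clinear V"
  shows "positive_on S (\<lambda>x. U\<dagger> (U x) - V\<dagger> (V x)) \<longleftrightarrow> (\<forall>x\<in>S. norm (V x) \<le> norm (U x))"
proof -
  have "cinner (U\<dagger> (U x) - V\<dagger> (V x)) x = of_real ((norm (U x))\<^sup>2 - (norm (V x))\<^sup>2)" for x
    unfolding cinner_diff_left cinner_cadjoint'[OF U] cinner_cadjoint'[OF V] cinner_self of_real_diff ..
  then show ?thesis
    by (simp add: positive_on_def abs_le_square_iff[symmetric] del: of_real_diff)
qed

theorem theorem4p6:
  fixes Z :: "'n::finite \<Rightarrow> 'e::complex_hilbert \<Rightarrow> 'e"
    and B :: "nat \<Rightarrow> 'e \<Rightarrow> 'e"
    and l :: nat
  assumes "l \<ge> 1"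
    and "Z \<in> Z_ball"
    and "\<And>k. k \<le> l \<Longrightarrow> bounded_clinear (B k)"
  shows "(\<exists>T \<in> Schur. \<forall>k \<le> l. total_deriv k T Z = B k) \<longleftrightarrow>
    positive_on (supported_on {..l})
      (\<lambda>x. (U_inf l Z)\<dagger> (U_inf l Z x) - (V_inf l Z B)\<dagger> (V_inf l Z B x))"
proof -
  note Z = assms(2) and B = assms(3)
  define G where "G = back_nat l Z"
  define u where "u x = x $$ (0::nat)" for x :: "(nat, 'e) hsum"
  define v where "v x = (\<Sum>k\<le>l. B k (x $$ k))" for x :: "(nat, 'e) hsum"
  have G: "stable G" unfolding G_def by (rule stable_back_nat[OF Z])
  have u: "bounded_clinear u" unfolding u_def by (rule bounded_clinear_hnth)
  have v: "bounded_clinear v" unfolding v_def by (rule V_inf_eq(2)[OF Z B])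
  have U: "U_inf l Z = column G u" unfolding G_def u_def[abs_def] by (rule U_inf_eq[OF Z])
  have V: "V_inf l Z B = column G v" unfolding G_def v_def[abs_def] by (rule V_inf_eq(1)[OF Z B])
  note U_cl = bounded_clinear_column_stable[OF G u]
  note V_nth = hnth_column_stable[OF G v]
  have v_single: "v (hsingle k x) = B k x" if "k \<le> l" for k x
  proof -
    have "v (hsingle k x) = (\<Sum>j\<le>l. if j = k then B k x else 0)"
      unfolding v_def by (rule sum.cong) (auto simp: hnth_hsingle bounded_clinear_zero[OF B])
    then show ?thesis using that by simp
  qed
  have nth: "G k x $$ j = (if j \<le> l then Z k (x $$ j) + (if Suc j \<le> l then x $$ Suc j else 0) else 0)" for k x j
    by (simp add: G_def hnth_backward)
  \<comment> \<open>The type \<open>(nat, 'e) hsum\<close> has infinitely many blocks;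
    \<open>p\<close> projects to those up to \<open>l\<close>, which are all that the two columns
    see.\<close>
  define p where "p x = (\<Sum>k\<le>l. hsingle k (x $$ k))" for x :: "(nat, 'e) hsum"
  have p_nth: "p x $$ j = (if j \<le> l then x $$ j else 0)" for x j
    by (simp add: p_def hnth_sum hnth_hsingle)
  have Gp: "G k (p x) = G k x" for k x
    by (rule hsum_eqI) (simp add: nth p_nth)
  have column_p: "column G f (p x) = column G f x" if "bounded_clinear f" "\<And>x. f (p x) = f x" for f :: "_ \<Rightarrow> 'e" and x
  proof (rule hsum_eqI)
    fix \<sigma>
    show "column G f (p x) $$ \<sigma> = column G f x $$ \<sigma>"
      using that by (cases \<sigma>) (auto simp: hnth_column_stable[OF G] Gp)
  qed
  have "(\<exists>T \<in> Schur. \<forall>k \<le> l. total_deriv k T Z = B k) \<longleftrightarrow> (\<forall>x\<in>supported_on {..l}. norm (column G v x) \<le> norm (column G u x))"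
  proof
    assume "\<exists>T \<in> Schur. \<forall>k \<le> l. total_deriv k T Z = B k"
    then obtain T where T: "T \<in> Schur" and der: "\<And>k. k \<le> l \<Longrightarrow> total_deriv k T Z = B k" by blast
    have Tn: "norm (T y) \<le> norm y" for y using T by (simp add: Schur_def)
    have Tcl: "bounded_clinear T" and Tshift: "\<And>a y. bshift a (T y) = T (bshift a y)"
      using T by (auto simp: Schur_def UT_iff)
    show "\<forall>x\<in>supported_on {..l}. norm (column G v x) \<le> norm (column G u x)"
    proof
      fix x :: "(nat, 'e) hsum" assume "x \<in> supported_on {..l}"
      \<comment> \<open>On the vectors \<open>hsingle k x\<close> with \<open>k \<le> l\<close> this
        is the interpolation condition; linearity and the projection \<open>p\<close> give it for
        every \<open>z\<close>.\<close>
      have root: "T (column G u z) $$ [] = v z" for z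
      proof -
        have "T (column G u z) $$ [] = T (column G u (p z)) $$ []"
          by (simp add: column_p[OF u] u_def p_nth)
        also have "\<dots> = (\<Sum>k\<le>l. T (column G u (hsingle k (z $$ k))) $$ [])"
          by (simp add: p_def bounded_clinear_sum[OF U_cl] bounded_clinear_sum[OF Tcl] hnth_sum)
        also have "\<dots> = (\<Sum>k\<le>l. B k (z $$ k))"
          by (rule sum.cong) (auto simp: der[symmetric] total_deriv_eq[OF Z Tcl] U)
        finally show ?thesis by (simp add: v_def)
      qed
      \<comment> \<open>Agreement at the root for every vector spreads to all words, since on both
        sides a backward shift amounts to an application of \<open>G\<close>.\<close>
      have "T (column G u x) = column G v x"
      proof (rule hsum_eqI)
        fix \<sigma>
        have "T (column G u x) $$ \<sigma> = fold bshift \<sigma> (T (column G u x)) $$ []"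
          by (simp add: hnth_fold_bshift)
        also have "fold bshift \<sigma> (T (column G u x)) = T (column G u (fold G \<sigma> x))"
        proof -
          have "T (column G u (G a x)) = bshift a (T (column G u x))" for a x
            by (simp add: Tshift bshift_column[OF G u])
          then show ?thesis
            using fold_commute_apply[of "\<lambda>x. T (column G u x)" G bshift \<sigma> x] by simp
        qed
        finally show "T (column G u x) $$ \<sigma> = column G v x $$ \<sigma>" by (simp add: root V_nth)
      qed
      then show "norm (column G v x) \<le> norm (column G u x)" using Tn by metis
    qed
  next
    assume le: "\<forall>x\<in>supported_on {..l}. norm (column G v x) \<le> norm (column G u x)"
    \<comment> \<open>The hypothesis covers \<open>supported_on {..l}\<close> only; passing from
      \<open>x\<close> to \<open>p x\<close> extends it to the whole type, as
      \<open>schur_intertwining\<close> requires.\<close>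
    have "norm (column G v x) \<le> norm (column G u x)" for x
    proof -
      have "p x \<in> supported_on {..l}" by (simp add: supported_on_def p_nth)
      then have "norm (column G v (p x)) \<le> norm (column G u (p x))" using le by blast
      then show ?thesis by (simp add: column_p[OF u] column_p[OF v] u_def v_def p_nth)
    qed
    then obtain T where T: "T \<in> Schur" and TU: "\<forall>x. T (column G u x) = column G v x"
      using schur_intertwining[OF G u v] by blast
    have Tcl: "bounded_clinear T" using T by (simp add: Schur_def UT_def)
    have "total_deriv k T Z = B k" if "k \<le> l" for k
      by (rule ext) (simp add: total_deriv_eq[OF Z Tcl that] U TU V_nth v_single that)
    then show "\<exists>T \<in> Schur. \<forall>k \<le> l. total_deriv k T Z = B k" using T by blast
  qed
  then show ?thesis
    unfolding U V positive_on_gramian_difference[OF U_cl bounded_clinear_column_stable[OF G v]] .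
qed

end
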